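(* Consider the induction equation $\partial_t\mathbf{u}+\nabla^\perp(\mathbf{b}\cdot\mathbf{u}^\perp)+\mathbf{b}\,\nabla\cdot\mathbf{u}=0$ on $\Omega=\mathbb{T}^2$, with a given vector field $\mathbf{b}$. Suppose that the initial condition $\mathbf{u}(t=0)=\mathbf{u}^0$ derives from a potential $f^0\in C^\infty(\Omega)$: $\mathbf{u}^0=\nabla^\perp f^0$. Let $f_h^0:=\pi^{\mathbb{C}_k}f^0\in\mathbb{C}_k$ and $$\mathbf{u}_h^0:=-(\nabla^\perp_{\mathscr{D}'}\cdot)^\star f_h^0\in\mathbf{B}^{\mathrm{curl}}_k .$$ Then $\nabla^\star\mathbf{u}_h^0=0$. Moreover, let $\mathbf{u}_h:[0,T)\to\mathbf{B}^{\mathrm{curl}}_k$ be differentiable in time with $\mathbf{u}_h(0)=\mathbf{u}_h^0$ and satisfy, for all $t$ and all $\mathbf{v}\in\mathbf{B}^{\mathrm{curl}}_k$, $$\sum_{C\in\mathcal{C}}\int_C\mathbf{v}\cdot\partial_t\mathbf{u}_h-\sum_{C\in\mathcal{C}}\int_C(\mathbf{b}\cdot\mathbf{u}_h^\perp)\,\nabla^\perp\cdot\mathbf{v}+\sum_{S\in\mathcal{S}}\int_S[\mathbf{v}]_S\cdot\widetilde{\mathbf{G}}+\sum_{C\in\mathcal{C}}\int_C\mathbf{v}\cdot\mathbf{b}\,(-\nabla^\star\mathbf{u}_h)=0,$$ where the numerical flux $\widetilde{\mathbf{G}}$ is orthogonal to $\mathbf{n}_S$ on every side $S\in\mathcal{S}$.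 Then $\nabla^\star\mathbf{u}_h(t)=0$ for all $t\in[0,T)$.
   Context: Notation: $\nabla=(\partial_x,\partial_y)$, $\nabla^{\perp}=(-\partial_y,\partial_x)$, so $\nabla^\perp\cdot\mathbf{v}=-\partial_yv_x+\partial_xv_y$; $\mathbf{u}^\perp=(-u_y,u_x)$. Mesh. $\Omega=\mathbb{T}^2$ is the flat two-dimensional torus, partitioned by a conforming mesh into a finite set $\mathcal{C}$ of straight-sided cells, either all triangles or all quadrangles. $\mathcal{S}$ is the set of sides. Each side $S$ is oriented once for all with unit normal $\mathbf{n}_S$; its left cell $L$ is the neighbouring cell for which $\mathbf{n}_S$ is outgoing, its right cell $R$ the one for which $\mathbf{n}_S$ is ingoing. The jump of a cellwise continuous (scalar or vector) function $f$ is $[f]_S=f_L-f_R$. Spaces ($k\ge0$ an integer). $\mathbb{P}_m$: polynomials of total degree $\le m$; $\mathbb{Q}_{i,j}$: polynomials of degree $\le i$ in $x$ and $\le j$ in $y$; $\mathbb{Q}_m=\mathbb{Q}_{m,m}$; spaces with a negative index are $\{0\}$. $\mathbb{A}_{k+1}$ is the space of continuous functions on $\Omega$ whose restriction to each cell is in $\mathbb{P}_{k+1}$ (triangular meshes) or $\mathbb{Q}_{k+1}$ (quadrangular meshes). $\mathbf{B}^{\mathrm{curl}}_k$ is a space of vector fields that are polynomial in each cell, with no continuity imposed between cells. $\mathbb{C}_k$ is the product of a space of discontinuous piecewise polynomials on the cells and a space of discontinuous piecewise polynomials on the sides; elements are written $f=(f^C,f^S)$. They are one of the following families: (1) discontinuous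 Nédélec: on triangles, locally $\mathbf{B}^{\mathrm{curl}}_k=\mathbb{P}_k^2+(-y,x)\widetilde{\mathbb{P}}_k$ with $\widetilde{\mathbb{P}}_k$ the homogeneous polynomials of degree $k$, and $\mathbb{C}_k$ is made of $\mathbb{P}_k$ on cells and $\mathbb{P}_k$ on sides; on quadrangles, locally $\mathbf{B}^{\mathrm{curl}}_k=\mathbb{Q}_{k,k+1}\times\mathbb{Q}_{k+1,k}$, and $\mathbb{C}_k$ is made of $\mathbb{Q}_k$ on cells and $\mathbb{P}_k$ on sides; (2) on triangles: locally $\mathbf{B}^{\mathrm{curl}}_k=\mathbb{P}_k^2$, and $\mathbb{C}_k$ is made of $\mathbb{P}_{k-1}$ on cells and $\mathbb{P}_k$ on sides; (3) on quadrangles: locally $\mathbf{B}^{\mathrm{curl}}_k=\big((\mathbb{Q}_{k,k}+\mathbb{Q}_{k-1,k+1})\times(\mathbb{Q}_{k,k}+\mathbb{Q}_{k+1,k-1})\big)\oplus\mathrm{Span}\,(x^ky^{k+1},\;x^{k+1}y^k)$, and $\mathbb{C}_k$ is made of $\mathbb{Q}_{k,k-1}+\mathbb{Q}_{k-1,k}$ on cells and $\mathbb{P}_k$ on sides. Distributional curl. For $\mathbf{u}\in\mathbf{B}^{\mathrm{curl}}_k$, $\nabla^\perp_{\mathscr{D}'}\cdot\mathbf{u}$ has cell component $\nabla^\perp\cdot\mathbf{u}$ and side component $[\mathbf{u}^\perp]_S\cdot\mathbf{n}_S$. Standing assumption: the mesh and the family of spaces are such that $\mathbb{A}_{k+1}\xrightarrow{\nabla}\mathbf{B}^{\mathrm{curl}}_k\xrightarrow{\nabla^\perp_{\mathscr{D}'}\cdot}\mathbb{C}_k$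 is well defined, i.e. each operator maps into the indicated space (this is the case for triangular meshes and for Cartesian meshes). Scalar products and adjoints. $\mathbb{A}_{k+1}$ and $\mathbf{B}^{\mathrm{curl}}_k$ carry the $L^2(\Omega)$ product; $\langle f|g\rangle_{\mathbb{C}_k}=\sum_{C\in\mathcal{C}}\int_Cf^Cg^C+\sum_{S\in\mathcal{S}}\int_Sf^Sg^S$. The operator $\nabla^\star:\mathbf{B}^{\mathrm{curl}}_k\to\mathbb{A}_{k+1}$ is defined by $\langle\nabla^\star\mathbf{u}|f\rangle_{\mathbb{A}_{k+1}}=\langle\mathbf{u}|\nabla f\rangle_{\mathbf{B}^{\mathrm{curl}}_k}$, and $(\nabla^\perp_{\mathscr{D}'}\cdot)^\star:\mathbb{C}_k\to\mathbf{B}^{\mathrm{curl}}_k$ by $\langle(\nabla^\perp_{\mathscr{D}'}\cdot)^\star f|\mathbf{u}\rangle_{\mathbf{B}^{\mathrm{curl}}_k}=\langle f|\nabla^\perp_{\mathscr{D}'}\cdot\mathbf{u}\rangle_{\mathbb{C}_k}$, for all arguments in the respective spaces. Projection. For $g\in C^\infty(\Omega)$, $\pi^{\mathbb{C}_k}g\in\mathbb{C}_k$ is defined by $\sum_C\int_Cg\varphi^C+\sum_S\int_Sg\varphi^S=\langle\pi^{\mathbb{C}_k}g|\varphi\rangle_{\mathbb{C}_k}$ for all $\varphi\in\mathbb{C}_k$. It is understood that $\mathbf{b}$ is independent of time and regular enough (e.g. bounded and measurable) and $\widetilde{\mathbf{G}}$ (single-valued on each side) is integrable on each side, so that all integrals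 make sense. *)

theory Defs
  imports "HOL-Analysis.Analysis" "HOL-Computational_Algebra.Polynomial"
begin

type_synonym pt = "real \<times> real"

section \<open>Planar vector calculus\<close>

definition perp :: "pt \<Rightarrow> pt" where
  "perp v = (- snd v, fst v)"

definition dx :: "(pt \<Rightarrow> real) \<Rightarrow> pt \<Rightarrow> real" where
  "dx f p = frechet_derivative f (at p) (1, 0)"

definition dy :: "(pt \<Rightarrow> real) \<Rightarrow> pt \<Rightarrow> real" where
  "dy f p = frechet_derivative f (at p) (0, 1)"

definition grad :: "(pt \<Rightarrow> real) \<Rightarrow> pt \<Rightarrow> pt" where
  "grad f p = (dx f p, dy f p)"

definition perp_grad :: "(pt \<Rightarrow> real) \<Rightarrow> pt \<Rightarrow> pt" where
  "perp_grad f p = (- dy f p, dx f p)"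

definition perp_div :: "(pt \<Rightarrow> pt) \<Rightarrow> pt \<Rightarrow> real" where
  "perp_div v p = - dy (fst \<circ> v) p + dx (snd \<circ> v) p"

fun C_times :: "nat \<Rightarrow> (pt \<Rightarrow> real) \<Rightarrow> bool" where
  "C_times 0 f \<longleftrightarrow> continuous_on UNIV f"
| "C_times (Suc m) f \<longleftrightarrow> (\<forall>p. f differentiable (at p)) \<and> C_times m (dx f) \<and> C_times m (dy f)"

definition C_infinity :: "(pt \<Rightarrow> real) \<Rightarrow> bool" where
  "C_infinity f \<longleftrightarrow> (\<forall>m. C_times m f)"

section \<open>Polygons\<close>

text \<open>A polygon is given by the cyclic list of its vertices, in either orientation.\<close>

fun polyline :: "pt list \<Rightarrow> real \<Rightarrow> pt" where
  "polyline [] = (\<lambda>_. 0)"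
| "polyline [a] = linepath a a"
| "polyline [a, b] = linepath a b"
| "polyline (a # b # c # vs) = linepath a b +++ polyline (b # c # vs)"

definition polygon_path :: "pt list \<Rightarrow> real \<Rightarrow> pt" where
  "polygon_path vs = polyline (vs @ [hd vs])"

definition region :: "pt list \<Rightarrow> pt set" where
  "region vs = path_image (polygon_path vs) \<union> inside (path_image (polygon_path vs))"

definition polygon_sides :: "pt list \<Rightarrow> pt set set" where
  "polygon_sides vs =
     {closed_segment (vs ! i) (vs ! (Suc i mod length vs)) | i. i < length vs}"

definition is_polygon :: "nat \<Rightarrow> pt list \<Rightarrow> bool" where
  "is_polygon n vs \<longleftrightarrow> length vs = n \<and> simple_path (polygon_path vs) \<and>
     (\<forall>i<n. \<not> collinear {vs ! i, vs ! (Suc i mod n), vs ! (Suc (Suc i) mod n)})"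

definition shift :: "pt \<Rightarrow> pt list \<Rightarrow> pt list" where
  "shift z vs = map ((+) z) vs"

definition conform :: "pt list \<Rightarrow> pt list \<Rightarrow> bool" where
  "conform V W \<longleftrightarrow> region V \<inter> region W = {}
     \<or> (\<exists>v \<in> set V \<inter> set W. region V \<inter> region W = {v})
     \<or> region V \<inter> region W \<in> polygon_sides V \<inter> polygon_sides W"

section \<open>Meshes of the torus\<close>

text \<open>
  The flat torus is the quotient of the plane by the lattice spanned by two independent
  periods, and functions on it are the lattice-periodic functions on the plane. A mesh lists one
  representative in the plane of each cell and of each side; the lattice translates of the
  representatives tile the plane. A side is an ordered pair \<open>(a, b)\<close> of end points, the order
  fixing the orientation of its normal. Since the representative of a side need not touch the
  representatives of its two neighbouring cells, \<open>left_cell\<close> and \<open>right_cell\<close> also record the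
  lattice vector \<open>z\<close> by which the neighbour has to be translated.
\<close>

type_synonym side = "pt \<times> pt"

record mesh =
  period1 :: pt
  period2 :: pt
  cells :: "pt list set"
  sides :: "side set"
  left_cell :: "side \<Rightarrow> pt list \<times> pt"
  right_cell :: "side \<Rightarrow> pt list \<times> pt"

definition lattice :: "mesh \<Rightarrow> pt set" where
  "lattice M = {of_int i *\<^sub>R period1 M + of_int j *\<^sub>R period2 M | i j :: int. True}"

definition periodic :: "mesh \<Rightarrow> (pt \<Rightarrow> 'a) \<Rightarrow> bool" where
  "periodic M f \<longleftrightarrow> (\<forall>z \<in> lattice M. \<forall>x. f (x + z) = f x)"

definition segment :: "side \<Rightarrow> pt set" where
  "segment S = closed_segment (fst S) (snd S)"

definition side_length :: "side \<Rightarrow> real" where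
  "side_length S = norm (snd S - fst S)"

definition side_point :: "side \<Rightarrow> real \<Rightarrow> pt" where
  "side_point S = linepath (fst S) (snd S)"

definition normal :: "side \<Rightarrow> pt" where
  "normal S = - perp ((snd S - fst S) /\<^sub>R side_length S)"

definition outgoing :: "pt \<Rightarrow> side \<Rightarrow> pt set \<Rightarrow> bool" where
  "outgoing n S K \<longleftrightarrow> (\<forall>x \<in> open_segment (fst S) (snd S).
     \<forall>\<^sub>F e in at_right 0. x - e *\<^sub>R n \<in> K \<and> x + e *\<^sub>R n \<notin> K)"

definition neighbour :: "mesh \<Rightarrow> pt \<Rightarrow> side \<Rightarrow> pt list \<times> pt \<Rightarrow> bool" where
  "neighbour M n S = (\<lambda>(C, z). C \<in> cells M \<and> z \<in> lattice M \<and>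
     segment S \<in> polygon_sides (shift z C) \<and> outgoing n S (region (shift z C)))"

text \<open>Each side is a side of a translated cell by the conditions on its neighbours, and the
  uniqueness in the last-but-one condition says that each side of the torus is listed only once,
  hence with a single orientation.\<close>

definition torus_mesh :: "nat \<Rightarrow> mesh \<Rightarrow> bool" where
  "torus_mesh n M \<longleftrightarrow>
     fst (period1 M) * snd (period2 M) - snd (period1 M) * fst (period2 M) \<noteq> 0 \<and>
     finite (cells M) \<and> finite (sides M) \<and>
     (\<forall>C \<in> cells M. is_polygon n C) \<and>
     (\<Union>C \<in> cells M. \<Union>z \<in> lattice M. region (shift z C)) = UNIV \<and>
     (\<forall>C \<in> cells M. \<forall>D \<in> cells M. \<forall>z \<in> lattice M.
        C \<noteq> D \<or> z \<noteq> 0 \<longrightarrow> conform C (shift z D)) \<and>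
     (\<forall>C \<in> cells M. \<forall>E \<in> polygon_sides C.
        \<exists>!S. S \<in> sides M \<and> (\<exists>z \<in> lattice M. E = (+) z ` segment S)) \<and>
     (\<forall>S \<in> sides M. neighbour M (normal S) S (left_cell M S) \<and>
        neighbour M (- normal S) S (right_cell M S))"

section \<open>Piecewise polynomial spaces\<close>

definition polys :: "(nat \<times> nat) set \<Rightarrow> (pt \<Rightarrow> real) set" where
  "polys I = {\<lambda>p. \<Sum>(a, b) \<in> I. c a b * fst p ^ a * snd p ^ b | c :: nat \<Rightarrow> nat \<Rightarrow> real. True}"

definition PP :: "int \<Rightarrow> (pt \<Rightarrow> real) set" where
  "PP m = polys {(a, b). int a + int b \<le> m}"

definition PP_hom :: "nat \<Rightarrow> (pt \<Rightarrow> real) set" where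
  "PP_hom m = polys {(a, b). a + b = m}"

definition QQ :: "int \<Rightarrow> int \<Rightarrow> (pt \<Rightarrow> real) set" where
  "QQ i j = polys {(a, b). int a \<le> i \<and> int b \<le> j}"

definition fsum :: "(pt \<Rightarrow> 'a :: plus) set \<Rightarrow> (pt \<Rightarrow> 'a) set \<Rightarrow> (pt \<Rightarrow> 'a) set" where
  "fsum V W = {\<lambda>p. f p + g p | f g. f \<in> V \<and> g \<in> W}"

definition fprod :: "(pt \<Rightarrow> real) set \<Rightarrow> (pt \<Rightarrow> real) set \<Rightarrow> (pt \<Rightarrow> pt) set" where
  "fprod V W = {\<lambda>p. (f p, g p) | f g. f \<in> V \<and> g \<in> W}"

datatype family = Nedelec_tri | Nedelec_quad | Full_tri | Enriched_quad

primrec corners :: "family \<Rightarrow> nat" where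
  "corners Nedelec_tri = 3"
| "corners Nedelec_quad = 4"
| "corners Full_tri = 3"
| "corners Enriched_quad = 4"

primrec A_loc :: "family \<Rightarrow> nat \<Rightarrow> (pt \<Rightarrow> real) set" where
  "A_loc Nedelec_tri k = PP (int k + 1)"
| "A_loc Nedelec_quad k = QQ (int k + 1) (int k + 1)"
| "A_loc Full_tri k = PP (int k + 1)"
| "A_loc Enriched_quad k = QQ (int k + 1) (int k + 1)"

primrec B_loc :: "family \<Rightarrow> nat \<Rightarrow> (pt \<Rightarrow> pt) set" where
  "B_loc Nedelec_tri k =
     fsum (fprod (PP (int k)) (PP (int k))) {\<lambda>p. q p *\<^sub>R perp p | q. q \<in> PP_hom k}"
| "B_loc Nedelec_quad k = fprod (QQ (int k) (int k + 1)) (QQ (int k + 1) (int k))"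
| "B_loc Full_tri k = fprod (PP (int k)) (PP (int k))"
| "B_loc Enriched_quad k =
     fsum (fprod (fsum (QQ (int k) (int k)) (QQ (int k - 1) (int k + 1)))
                 (fsum (QQ (int k) (int k)) (QQ (int k + 1) (int k - 1))))
          {\<lambda>p. c *\<^sub>R (fst p ^ k * snd p ^ (k + 1), fst p ^ (k + 1) * snd p ^ k) | c. True}"

primrec C_loc :: "family \<Rightarrow> nat \<Rightarrow> (pt \<Rightarrow> real) set" where
  "C_loc Nedelec_tri k = PP (int k)"
| "C_loc Nedelec_quad k = QQ (int k) (int k)"
| "C_loc Full_tri k = PP (int k - 1)"
| "C_loc Enriched_quad k = fsum (QQ (int k) (int k - 1)) (QQ (int k - 1) (int k))"

text \<open>
  A function which is polynomial in each cell, without continuity between cells, is a family of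
  polynomials on the plane indexed by the representative cells, of which only the restriction of
  the \<open>C\<close>-th one to \<open>region C\<close> matters; the families vanish at other indices, so that equality
  is equality of piecewise polynomials. Likewise a piecewise polynomial on the sides is a family
  of polynomials in the affine parameter of \<open>side_point S\<close>, which runs through \<open>S\<close> on
  \<open>{0..1}\<close>.
\<close>

type_synonym cellwise_vec = "pt list \<Rightarrow> pt \<Rightarrow> pt"
type_synonym cell_side = "(pt list \<Rightarrow> pt \<Rightarrow> real) \<times> (side \<Rightarrow> real \<Rightarrow> real)"

definition space_A :: "mesh \<Rightarrow> family \<Rightarrow> nat \<Rightarrow> (pt \<Rightarrow> real) set" where
  "space_A M F k = {f. periodic M f \<and> continuous_on UNIV f \<and>
     (\<forall>C \<in> cells M. \<exists>p \<in> A_loc F k. \<forall>x \<in> region C. f x = p x)}"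

definition space_B :: "mesh \<Rightarrow> family \<Rightarrow> nat \<Rightarrow> cellwise_vec set" where
  "space_B M F k = {u. (\<forall>C \<in> cells M. u C \<in> B_loc F k) \<and> (\<forall>C. C \<notin> cells M \<longrightarrow> u C = (\<lambda>_. 0))}"

definition space_C :: "mesh \<Rightarrow> family \<Rightarrow> nat \<Rightarrow> cell_side set" where
  "space_C M F k = {(f, g).
     (\<forall>C \<in> cells M. f C \<in> C_loc F k) \<and> (\<forall>C. C \<notin> cells M \<longrightarrow> f C = (\<lambda>_. 0)) \<and>
     (\<forall>S \<in> sides M. \<exists>p :: real poly. degree p \<le> k \<and> g S = poly p) \<and>
     (\<forall>S. S \<notin> sides M \<longrightarrow> g S = (\<lambda>_. 0))}"

section \<open>Discrete operators\<close>

definition cell_poly :: "(pt \<Rightarrow> real) \<Rightarrow> pt list \<Rightarrow> pt \<Rightarrow> real" where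
  "cell_poly f C = (THE p. real_polynomial_function p \<and> (\<forall>x \<in> region C. p x = f x))"

definition cell_grad :: "mesh \<Rightarrow> (pt \<Rightarrow> real) \<Rightarrow> cellwise_vec" where
  "cell_grad M f = (\<lambda>C. if C \<in> cells M then grad (cell_poly f C) else (\<lambda>_. 0))"

definition jump :: "mesh \<Rightarrow> (pt list \<Rightarrow> pt \<Rightarrow> 'a :: minus) \<Rightarrow> side \<Rightarrow> pt \<Rightarrow> 'a" where
  "jump M f S x =
     f (fst (left_cell M S)) (x - snd (left_cell M S)) -
     f (fst (right_cell M S)) (x - snd (right_cell M S))"

definition dist_curl :: "mesh \<Rightarrow> cellwise_vec \<Rightarrow> cell_side" where
  "dist_curl M u =
     ((\<lambda>C. if C \<in> cells M then perp_div (u C) else (\<lambda>_. 0)),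
      (\<lambda>S. if S \<in> sides M
           then (\<lambda>s. jump M (\<lambda>C x. perp (u C x)) S (side_point S s) \<bullet> normal S)
           else (\<lambda>_. 0)))"

definition well_defined_complex :: "mesh \<Rightarrow> family \<Rightarrow> nat \<Rightarrow> bool" where
  "well_defined_complex M F k \<longleftrightarrow>
     (\<forall>f \<in> space_A M F k. cell_grad M f \<in> space_B M F k) \<and>
     (\<forall>u \<in> space_B M F k. dist_curl M u \<in> space_C M F k)"

definition cell_integral :: "pt list \<Rightarrow> (pt \<Rightarrow> real) \<Rightarrow> real" where
  "cell_integral C f = set_lebesgue_integral lborel (region C) f"

text \<open>Integral along \<open>S\<close> with respect to arc length; the integrand is a function of the affine
  parameter.\<close>

definition side_integral :: "side \<Rightarrow> (real \<Rightarrow> real) \<Rightarrow> real" where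
  "side_integral S g = side_length S * set_lebesgue_integral lborel {0..1} g"

text \<open>The first two are the \<open>L\<^sup>2\<close> product on the torus, which is partitioned by the cells.\<close>

definition inner_A :: "mesh \<Rightarrow> (pt \<Rightarrow> real) \<Rightarrow> (pt \<Rightarrow> real) \<Rightarrow> real" where
  "inner_A M f g = (\<Sum>C \<in> cells M. cell_integral C (\<lambda>x. f x * g x))"

definition inner_B :: "mesh \<Rightarrow> cellwise_vec \<Rightarrow> cellwise_vec \<Rightarrow> real" where
  "inner_B M u v = (\<Sum>C \<in> cells M. cell_integral C (\<lambda>x. u C x \<bullet> v C x))"

definition inner_C :: "mesh \<Rightarrow> cell_side \<Rightarrow> cell_side \<Rightarrow> real" where
  "inner_C M f g =
     (\<Sum>C \<in> cells M. cell_integral C (\<lambda>x. fst f C x * fst g C x)) +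
     (\<Sum>S \<in> sides M. side_integral S (\<lambda>s. snd f S s * snd g S s))"

definition represent :: "'a set \<Rightarrow> ('a \<Rightarrow> 'a \<Rightarrow> real) \<Rightarrow> ('a \<Rightarrow> real) \<Rightarrow> 'a" where
  "represent X ip l = (THE x. x \<in> X \<and> (\<forall>y \<in> X. ip x y = l y))"

definition grad_star :: "mesh \<Rightarrow> family \<Rightarrow> nat \<Rightarrow> cellwise_vec \<Rightarrow> pt \<Rightarrow> real" where
  "grad_star M F k u =
     represent (space_A M F k) (inner_A M) (\<lambda>f. inner_B M u (cell_grad M f))"

definition dist_curl_star :: "mesh \<Rightarrow> family \<Rightarrow> nat \<Rightarrow> cell_side \<Rightarrow> cellwise_vec" where
  "dist_curl_star M F k f =
     represent (space_B M F k) (inner_B M) (\<lambda>u. inner_C M f (dist_curl M u))"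

definition proj_C :: "mesh \<Rightarrow> family \<Rightarrow> nat \<Rightarrow> (pt \<Rightarrow> real) \<Rightarrow> cell_side" where
  "proj_C M F k g = represent (space_C M F k) (inner_C M)
     (\<lambda>\<phi>. (\<Sum>C \<in> cells M. cell_integral C (\<lambda>x. g x * fst \<phi> C x)) +
          (\<Sum>S \<in> sides M. side_integral S (\<lambda>s. g (side_point S s) * snd \<phi> S s)))"

end

theory Submission
  imports Defs "HOL-Library.Function_Algebras"
begin

text \<open>The argument rests on one identity: the distributional curl of the gradient of a function of the
  continuous space vanishes. Inside a cell this is the symmetry of second derivatives
  (\<open>perp_div_grad\<close>). On a side, the jump of the rotated gradient against the normal is, up to sign,
  the jump of the gradient against the tangent, and the tangential derivatives from both sides are
  those of the same continuous function (\<open>tangential_jump_grad\<close>).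

  Therefore a field in the range of the adjoint of the distributional curl is orthogonal to
  all gradients (\<open>initial_orthogonal\<close>), which says that its discrete divergence is zero.

  For the evolution, test the scheme with the gradient of a function \<open>f\<close>. The curl term vanishes by
  the identity in the cells. The flux term vanishes because the flux is tangential while the jump
  of the gradient is normal. What is left expresses the time derivative of
  \<open>inner_A M (grad_star M F k (uh t)) f\<close> as a linear functional of \<open>grad_star M F k (uh t)\<close>. This is a
  closed linear system of ordinary differential equations in a finite-dimensional space, and it
  starts at zero, so it stays at zero by Gronwall's inequality (\<open>linear_ode_zero\<close>,
  \<open>grad_star_stays_zero\<close>).

  The remaining work makes the discrete objects meaningful. The adjoints and the projection are
  definite descriptions; they exist and are unique by the Riesz representation theorem (\<open>riesz\<close>)
  because the three spaces are finite-dimensional and the scalar products are definite.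
  Definiteness uses that a cell has interior points (\<open>polygon_region\<close>, from the Jordan--Brouwer
  separation theorem) and that a polynomial is determined by its values on an open set. The
  time derivative is given pointwise; finite dimension turns it into the derivative of every linear
  functional (\<open>pointwise_derivative_finite_dim\<close>).\<close>

section \<open>Finite-dimensional inner product spaces of functions\<close>

text \<open>Piecewise polynomial fields are families of functions. With the pointwise operations every
  function type into a real vector space is one as well, so that spans, linear maps and
  subspaces of all three discrete spaces are covered by the general theory.\<close>

instantiation "fun" :: (type, real_vector) real_vector
begin

definition scaleR_fun_def: "c *\<^sub>R f = (\<lambda>x. c *\<^sub>R f x)"

instance
  by standard (simp_all add: scaleR_fun_def fun_eq_iff algebra_simps)

end

lemma scaleR_fun_apply [simp]: "(c *\<^sub>R f) x = c *\<^sub>R f x"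
  by (simp add: scaleR_fun_def)

lemma sum_fun_apply [simp]: "(\<Sum>i\<in>I. f i) x = (\<Sum>i\<in>I. f i x)"
  by (induction I rule: infinite_finite_induct) simp_all

text \<open>The ambient function types are infinite-dimensional; being contained in a finitely generated
  span passes to images, sums and subsets without choosing a basis.\<close>

definition finite_dim :: "'v::real_vector set \<Rightarrow> bool" where
  "finite_dim V \<longleftrightarrow> (\<exists>B. finite B \<and> V \<subseteq> span B)"

lemma finite_dim_span: "finite B \<Longrightarrow> finite_dim (span B)"
  by (auto simp: finite_dim_def)

lemma finite_dim_subset: "finite_dim W \<Longrightarrow> V \<subseteq> W \<Longrightarrow> finite_dim V"
  by (force simp: finite_dim_def)

lemma finite_dim_linear_image:
  assumes "linear h" "finite_dim V"
  shows "finite_dim (h ` V)"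
proof -
  obtain B where B: "finite B" "V \<subseteq> span B"
    using assms(2) by (auto simp: finite_dim_def)
  then have "h ` V \<subseteq> span (h ` B)"
    using linear_span_image[OF assms(1), of B] by blast
  with B(1) show ?thesis
    by (auto simp: finite_dim_def)
qed

lemma finite_dim_sum_set:
  assumes "finite_dim V" "finite_dim W"
  shows "finite_dim {x + y | x y. x \<in> V \<and> y \<in> W}"
proof -
  obtain A B where AB: "finite A" "V \<subseteq> span A" "finite B" "W \<subseteq> span B"
    using assms by (auto simp: finite_dim_def)
  have "{x + y | x y. x \<in> V \<and> y \<in> W} \<subseteq> span (A \<union> B)"
    using AB by (auto simp: span_Un)
  with AB show ?thesis
    unfolding finite_dim_def by (meson finite_Un)
qed

lemma finite_dim_basis:
  assumes "finite_dim V" "subspace V"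
  obtains B where "finite B" "B \<subseteq> V" "span B = V"
proof -
  obtain A where A: "finite A" "V \<subseteq> span A"
    using assms by (auto simp: finite_dim_def)
  obtain B where B: "B \<subseteq> V" "independent B" "V \<subseteq> span B"
    using maximal_independent_subset[of V] by metis
  have "finite B"
    using independent_span_bound[OF A(1) B(2)] B(1) A(2) by auto
  moreover have "span B = V"
    using B span_minimal[OF B(1) assms(2)] by auto
  ultimately show thesis
    using that B(1) by blast
qed

text \<open>The scalar products are integrals and the discrete operators are derivatives; both are additive
  only on the spaces of polynomial fields, where they behave well, so linearity has to be relative
  to the space.\<close>

definition linear_form_on :: "'v::real_vector set \<Rightarrow> ('v \<Rightarrow> real) \<Rightarrow> bool" where
  "linear_form_on V l \<longleftrightarrow>
     (\<forall>x\<in>V. \<forall>y\<in>V. l (x + y) = l x + l y) \<and> (\<forall>x\<in>V. \<forall>c. l (c *\<^sub>R x) = c * l x)"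

lemma linear_form_on_sum:
  assumes V: "subspace V" and l: "linear_form_on V l" and E: "finite E" "E \<subseteq> V"
  shows "l (\<Sum>e\<in>E. c e *\<^sub>R e) = (\<Sum>e\<in>E. c e * l e)"
  using E
proof (induction E rule: finite_induct)
  case empty
  have "l (0 *\<^sub>R 0) = 0 * l 0"
    using l subspace_0[OF V] unfolding linear_form_on_def by blast
  then show ?case by simp
next
  case (insert e E)
  have "(\<Sum>e\<in>E. c e *\<^sub>R e) \<in> V" "c e *\<^sub>R e \<in> V" "e \<in> V"
    using insert.prems V by (auto intro!: subspace_sum subspace_scale)
  then show ?case
    using insert l unfolding linear_form_on_def by simp
qed

locale inner_space_on =
  fixes V :: "'v::real_vector set" and ip :: "'v \<Rightarrow> 'v \<Rightarrow> real"
  assumes subspace: "subspace V" and finite_dim: "finite_dim V"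
    and linear_form: "y \<in> V \<Longrightarrow> linear_form_on V (\<lambda>x. ip x y)"
    and sym: "x \<in> V \<Longrightarrow> y \<in> V \<Longrightarrow> ip x y = ip y x"
    and nonneg: "x \<in> V \<Longrightarrow> 0 \<le> ip x x"
    and definite: "x \<in> V \<Longrightarrow> ip x x = 0 \<Longrightarrow> x = 0"
begin

definition orthonormal :: "'v set \<Rightarrow> bool" where
  "orthonormal E \<longleftrightarrow> finite E \<and> E \<subseteq> V \<and> (\<forall>e\<in>E. \<forall>e'\<in>E. ip e e' = (if e = e' then 1 else 0))"

lemma ip_scale: "x \<in> V \<Longrightarrow> y \<in> V \<Longrightarrow> ip (c *\<^sub>R x) y = c * ip x y"
  using linear_form by (auto simp: linear_form_on_def)

lemma linear_form_right:
  assumes y: "y \<in> V"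
  shows "linear_form_on V (ip y)"
proof -
  have "ip y x = ip x y" if "x \<in> V" for x using sym[OF y that] .
  then show ?thesis
    using linear_form[OF y] subspace_add[OF subspace] subspace_scale[OF subspace]
    by (simp add: linear_form_on_def)
qed

lemma ip_diff: "x \<in> V \<Longrightarrow> x' \<in> V \<Longrightarrow> y \<in> V \<Longrightarrow> ip (x - x') y = ip x y - ip x' y"
proof -
  assume *: "x \<in> V" "x' \<in> V" "y \<in> V"
  then have "ip (x + (-1) *\<^sub>R x') y = ip x y + (-1) * ip x' y"
    using linear_form[of y] subspace_scale[OF subspace, of x' "-1"]
    unfolding linear_form_on_def by metis
  then show ?thesis by simp
qed

lemma ip_sum_orthonormal:
  assumes "orthonormal E" "e \<in> E"
  shows "ip (\<Sum>e'\<in>E. c e' *\<^sub>R e') e = c e"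
proof -
  have "ip (\<Sum>e'\<in>E. c e' *\<^sub>R e') e = (\<Sum>e'\<in>E. c e' * ip e' e)"
    using assms linear_form_on_sum[OF subspace linear_form, of e E c]
    by (auto simp: orthonormal_def)
  also have "\<dots> = (\<Sum>e'\<in>E. if e' = e then c e else 0)"
    using assms by (intro sum.cong) (auto simp: orthonormal_def)
  also have "\<dots> = c e"
    using assms by (simp add: orthonormal_def)
  finally show ?thesis .
qed

text \<open>The classical process: a new vector is replaced by its normalised component orthogonal to the
  span so far, and is dropped when that component vanishes.\<close>

lemma gram_schmidt:
  assumes "finite B" "B \<subseteq> V"
  shows "\<exists>E. orthonormal E \<and> span E = span B"
  using assms
proof (induction B rule: finite_induct)
  case empty
  then show ?case by (auto simp: orthonormal_def intro!: exI[of _ "{}"])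
next
  case (insert b B)
  then obtain E where E: "orthonormal E" "span E = span B" by auto
  then have EV: "finite E" "E \<subseteq> V" by (auto simp: orthonormal_def)
  have b: "b \<in> V" using insert by auto
  define p where "p = (\<Sum>e\<in>E. ip b e *\<^sub>R e)"
  define r where "r = b - p"
  have pE: "p \<in> span E"
    unfolding p_def by (intro span_sum span_scale span_base)
  have pV: "p \<in> V"
    using pE span_minimal[OF EV(2) subspace] by auto
  have rV: "r \<in> V"
    unfolding r_def by (intro subspace_diff subspace b pV)
  have re: "ip r e = 0" if "e \<in> E" for e
    using ip_diff[of b p e] ip_sum_orthonormal[OF E(1) that] that EV b pV
    by (auto simp: r_def p_def)
  show ?case
  proof (cases "r = 0")
    case True
    then have "b \<in> span B" using pE E(2) by (simp add: r_def)
    then show ?thesis using E span_redundant[of b B] by auto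
  next
    case False
    define n where "n = ip r r"
    have n: "n > 0"
      using False definite[OF rV] nonneg[OF rV] by (force simp: n_def)
    define q where "q = (1 / sqrt n) *\<^sub>R r"
    have qV: "q \<in> V" unfolding q_def by (intro subspace_scale subspace rV)
    have qe: "ip q e = 0" if "e \<in> E" for e
      using re[OF that] ip_scale[OF rV, of e] that EV by (auto simp: q_def)
    have sq: "sqrt n * sqrt n = n" "sqrt n \<noteq> 0" using n by auto
    have "ip q q = (1 / sqrt n) * ip r q"
      using ip_scale[OF rV qV] by (simp add: q_def)
    also have "ip r q = (1 / sqrt n) * n"
      using ip_scale[OF rV rV] sym[OF rV qV] by (simp add: q_def n_def)
    also have "(1 / sqrt n) * ((1 / sqrt n) * n) = n / (sqrt n * sqrt n)"
      by (metis divide_divide_eq_left mult_1 times_divide_eq_left)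
    also have "\<dots> = n / n" by (simp only: sq(1))
    also have "\<dots> = 1" using n by simp
    finally have qq: "ip q q = 1" .
    have "q \<notin> E"
      using qe qq by force
    then have "orthonormal (insert q E)"
      unfolding orthonormal_def
    proof (intro conjI ballI)
      fix e e' assume "e \<in> insert q E" "e' \<in> insert q E"
      moreover have "ip e q = 0" if "e \<in> E" for e
        using qe[OF that] sym[OF qV, of e] that EV by auto
      ultimately show "ip e e' = (if e = e' then 1 else 0)"
        using E(1) qe qq \<open>q \<notin> E\<close> unfolding orthonormal_def by (elim insertE) auto
    qed (use EV qV in auto)
    moreover have "span (insert q E) = span (insert b E)"
    proof (rule span_eq[THEN iffD2], safe)
      have "b = sqrt n *\<^sub>R q + p" using n by (simp add: q_def r_def)
      then show "b \<in> span (insert q E)"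
        using pE span_mono[of E "insert q E"]
        by (auto intro!: span_add span_scale intro: span_base)
      show "q \<in> span (insert b E)"
        unfolding q_def r_def using pE span_mono[of E "insert b E"]
        by (auto intro!: span_scale span_diff intro: span_base)
    qed (auto intro: span_base)
    moreover have "span (insert b E) = span (insert b B)"
      using E(2) by (simp add: span_insert)
    ultimately show ?thesis by metis
  qed
qed

lemma ip_self_zero_on_V: "x \<in> V \<Longrightarrow> (\<forall>y\<in>V. ip x y = 0) \<Longrightarrow> x = 0"
  using definite by blast

lemma orthonormal_basis:
  obtains E where "orthonormal E"
    and "\<forall>x\<in>V. x = (\<Sum>e\<in>E. ip x e *\<^sub>R e)"
proof -
  obtain B where B: "finite B" "B \<subseteq> V" "span B = V"
    using finite_dim_basis[OF finite_dim subspace] .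
  then obtain E where E: "orthonormal E" "span E = V"
    using gram_schmidt by metis
  then have fE: "finite E" by (simp add: orthonormal_def)
  have "x = (\<Sum>e\<in>E. ip x e *\<^sub>R e)" if x: "x \<in> V" for x
  proof -
    obtain c where "x = (\<Sum>e\<in>E. c e *\<^sub>R e)"
      using x E(2) span_finite[OF fE] by auto
    then show ?thesis
      using ip_sum_orthonormal[OF E(1), of _ c] by simp
  qed
  then show thesis using E(1) by (intro that[of E]) auto
qed

text \<open>For an orthonormal basis the representing vector of \<open>l\<close> is \<open>\<Sum>e\<in>E. l e *\<^sub>R e\<close>; definiteness
  makes it unique. Hence the definite descriptions behind the discrete adjoints and the projection
  denote.\<close>

lemma riesz:
  assumes l: "linear_form_on V l"
  shows "\<exists>!x. x \<in> V \<and> (\<forall>y\<in>V. ip x y = l y)"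
proof -
  obtain E where E: "orthonormal E" "\<forall>x\<in>V. x = (\<Sum>e\<in>E. ip x e *\<^sub>R e)"
    by (rule orthonormal_basis)
  have EV: "finite E" "E \<subseteq> V" using E(1) by (auto simp: orthonormal_def)
  define x where "x = (\<Sum>e\<in>E. l e *\<^sub>R e)"
  have xV: "x \<in> V"
    unfolding x_def using EV by (auto intro!: subspace_sum subspace_scale subspace)
  have "ip x y = l y" if y: "y \<in> V" for y
  proof -
    have "ip x y = (\<Sum>e\<in>E. l e * ip e y)"
      unfolding x_def by (rule linear_form_on_sum[OF subspace linear_form EV]) fact
    also have "\<dots> = (\<Sum>e\<in>E. ip y e * l e)"
      using y EV by (intro sum.cong) (auto simp: sym)
    also have "\<dots> = l (\<Sum>e\<in>E. ip y e *\<^sub>R e)"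
      by (rule linear_form_on_sum[OF subspace l EV, symmetric])
    also have "\<dots> = l y" by (rule arg_cong[OF bspec[OF E(2) y, symmetric]])
    finally show ?thesis .
  qed
  moreover have "x' = x''"
    if "x' \<in> V" "\<forall>y\<in>V. ip x' y = l y" "x'' \<in> V" "\<forall>y\<in>V. ip x'' y = l y" for x' x''
    using ip_self_zero_on_V[of "x' - x''"] that ip_diff subspace_diff[OF subspace] by force
  ultimately show ?thesis using xV by blast
qed

lemma represent_in: "linear_form_on V l \<Longrightarrow> represent V ip l \<in> V"
  and ip_represent: "linear_form_on V l \<Longrightarrow> y \<in> V \<Longrightarrow> ip (represent V ip l) y = l y"
  using theI'[OF riesz[of l]] by (auto simp: represent_def)

lemma represent_zero:
  assumes "\<forall>y\<in>V. l y = 0"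
  shows "represent V ip l = 0"
proof -
  have l: "linear_form_on V l"
    using assms subspace by (auto simp: linear_form_on_def subspace_def)
  show ?thesis
    using represent_in[OF l] ip_represent[OF l] assms definite by auto
qed

end

text \<open>Induction over the generators. A new generator enlarges the common kernel of the evaluations at
  the points found so far by at most one dimension, and one further point at which a nonzero
  element \<open>f\<close> of that kernel does not vanish removes it again.\<close>

lemma finite_separating_points:
  fixes ev :: "'i \<Rightarrow> 'v::real_vector \<Rightarrow> 'w::real_vector"
  assumes lin: "\<And>i. linear (ev i)" and "finite B"
    and sep: "\<And>x. x \<in> span B \<Longrightarrow> (\<forall>i. ev i x = 0) \<Longrightarrow> x = 0"
  obtains P where "finite P" "\<And>x. x \<in> span B \<Longrightarrow> (\<forall>i\<in>P. ev i x = 0) \<Longrightarrow> x = 0"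
proof -
  have "\<exists>P. finite P \<and> (\<forall>x\<in>span B. (\<forall>i\<in>P. ev i x = 0) \<longrightarrow> x = 0)"
    using \<open>finite B\<close> sep
  proof (induction B rule: finite_induct)
    case empty
    show ?case by (intro exI[of _ "{}"]) auto
  next
    case (insert b B)
    have sub: "span B \<subseteq> span (insert b B)" by (rule span_mono) auto
    then have "\<And>x. x \<in> span B \<Longrightarrow> (\<forall>i. ev i x = 0) \<Longrightarrow> x = 0"
      using insert.prems by blast
    then obtain P where P: "finite P" "\<And>x. x \<in> span B \<Longrightarrow> (\<forall>i\<in>P. ev i x = 0) \<Longrightarrow> x = 0"
      using insert.IH by blast
    show ?case
    proof (cases "\<exists>f\<in>span (insert b B). f \<noteq> 0 \<and> (\<forall>i\<in>P. ev i f = 0)")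
      case False
      then show ?thesis using P(1) by blast
    next
      case True
      then obtain f where f: "f \<in> span (insert b B)" "f \<noteq> 0" "\<forall>i\<in>P. ev i f = 0" by blast
      then obtain i where i: "ev i f \<noteq> 0" using insert.prems by blast
      obtain c where c: "f - c *\<^sub>R b \<in> span B" using f(1) by (auto simp: span_breakdown_eq)
      have c0: "c \<noteq> 0" using c P(2)[of f] f by auto
      \<comment> \<open>the element \<open>h - (d / c) *\<^sub>R f\<close> has no \<open>b\<close>-component and vanishes on \<open>P\<close>, so it is zero; evaluating at \<open>i\<close> then gives \<open>d = 0\<close>\<close>
      have "h = 0" if h: "h \<in> span (insert b B)" "\<forall>j\<in>insert i P. ev j h = 0" for h
      proof -
        obtain d where d: "h - d *\<^sub>R b \<in> span B" using h(1) by (auto simp: span_breakdown_eq)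
        have "h - (d / c) *\<^sub>R f = (h - d *\<^sub>R b) - (d / c) *\<^sub>R (f - c *\<^sub>R b)"
          using c0 by (simp add: algebra_simps)
        moreover have "(h - d *\<^sub>R b) - (d / c) *\<^sub>R (f - c *\<^sub>R b) \<in> span B"
          by (intro span_diff span_scale c d)
        ultimately have "h - (d / c) *\<^sub>R f \<in> span B" by metis
        moreover have "ev j (h - (d / c) *\<^sub>R f) = 0" if "j \<in> P" for j
          using that f h by (simp add: linear_diff[OF lin] linear_scale[OF lin])
        ultimately have hf: "h = (d / c) *\<^sub>R f"
          using P(2)[of "h - (d / c) *\<^sub>R f"] by simp
        have "ev i h = 0" using h(2) by simp
        then have "(d / c) *\<^sub>R ev i f = 0" using hf linear_scale[OF lin[of i]] by metis
        then show ?thesis using i hf by simp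
      qed
      then show ?thesis using P(1) by (intro exI[of _ "insert i P"]) auto
    qed
  qed
  then obtain P where "finite P" "\<forall>x\<in>span B. (\<forall>i\<in>P. ev i x = 0) \<longrightarrow> x = 0"
    by (elim exE conjE)
  then show thesis by (intro that[of P]) auto
qed

text \<open>A curve that stays in a finite-dimensional space and is differentiable at every evaluation point
  is differentiable as a curve in that space: evaluations at finitely many separating points
  define a scalar product, whose coordinates are finite combinations of point values. This turns
  the pointwise time derivative of the discrete solution into the derivative of every linear
  functional of it, without differentiating under an integral.\<close>

lemma pointwise_derivative_finite_dim:
  fixes ev :: "'i \<Rightarrow> 'v::real_vector \<Rightarrow> 'w::real_inner"
  assumes V: "subspace V" "finite_dim V" and lin: "\<And>i. linear (ev i)"
    and sep: "\<And>x. (\<forall>i. ev i x = 0) \<Longrightarrow> x = 0"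
    and h: "\<And>\<tau>. \<tau> \<in> S \<Longrightarrow> h \<tau> \<in> V" and t: "t \<in> S" "at t within S \<noteq> bot"
    and deriv: "\<And>i. ((\<lambda>\<tau>. ev i (h \<tau>)) has_vector_derivative ev i h') (at t within S)"
  shows "h' \<in> V"
    and "linear_form_on V l \<Longrightarrow> ((\<lambda>\<tau>. l (h \<tau>)) has_real_derivative l h') (at t within S)"
proof -
  obtain B where B: "finite B" "B \<subseteq> V" "span B = V"
    using finite_dim_basis[OF V(2,1)] .
  obtain P where P: "finite P" "\<And>x. x \<in> V \<Longrightarrow> (\<forall>i\<in>P. ev i x = 0) \<Longrightarrow> x = 0"
    using finite_separating_points[of ev B] lin B sep by metis
  \<comment> \<open>definite on \<open>V\<close> because \<open>P\<close> separates its elements\<close>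
  define ip where "ip x y = (\<Sum>i\<in>P. ev i x \<bullet> ev i y)" for x y
  interpret inner_space_on V ip
  proof
    show "linear_form_on V (\<lambda>x. ip x y)" for y
      by (simp add: linear_form_on_def ip_def linear_add[OF lin] linear_scale[OF lin]
          inner_add_left sum.distrib sum_distrib_left)
    show "ip x y = ip y x" for x y by (simp add: ip_def inner_commute)
    show "0 \<le> ip x x" for x by (simp add: ip_def sum_nonneg)
    show "x = 0" if "x \<in> V" "ip x x = 0" for x
    proof (rule P(2)[OF that(1)])
      show "\<forall>i\<in>P. ev i x = 0"
        using that(2) P(1) by (simp add: ip_def sum_nonneg_eq_0_iff)
    qed
  qed (use V in auto)
  obtain E where E: "orthonormal E" "\<forall>x\<in>V. x = (\<Sum>e\<in>E. ip x e *\<^sub>R e)"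
    by (rule orthonormal_basis)
  have EV: "finite E" "E \<subseteq> V" using E(1) by (auto simp: orthonormal_def)
  have ipd: "((\<lambda>\<tau>. ip (h \<tau>) e) has_real_derivative ip h' e) (at t within S)" for e
  proof -
    have "((\<lambda>\<tau>. ip (h \<tau>) e) has_vector_derivative ip h' e) (at t within S)"
      unfolding ip_def
      by (intro has_vector_derivative_sum bounded_linear.has_vector_derivative[OF bounded_linear_inner_left] deriv)
    then show ?thesis by (simp add: has_real_derivative_iff_has_vector_derivative)
  qed
  \<comment> \<open>both sides are the derivative of the same curve at each evaluation point\<close>
  have h'_eq: "h' = (\<Sum>e\<in>E. ip h' e *\<^sub>R e)"
  proof -
    have "ev i h' = ev i (\<Sum>e\<in>E. ip h' e *\<^sub>R e)" for i
    proof (rule vector_derivative_unique_within[OF t(2)])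
      show "((\<lambda>\<tau>. ev i (h \<tau>)) has_vector_derivative ev i h') (at t within S)" by (rule deriv)
      have "((\<lambda>\<tau>. \<Sum>e\<in>E. ip (h \<tau>) e *\<^sub>R ev i e) has_vector_derivative
          (\<Sum>e\<in>E. ip h' e *\<^sub>R ev i e)) (at t within S)"
        by (intro has_vector_derivative_sum)
          (use ipd in \<open>auto intro!: derivative_eq_intros simp: has_real_derivative_iff_has_vector_derivative\<close>)
      moreover have "(\<Sum>e\<in>E. ip x e *\<^sub>R ev i e) = ev i (\<Sum>e\<in>E. ip x e *\<^sub>R e)" for x
        by (simp add: linear_sum[OF lin] linear_scale[OF lin])
      moreover have "ev i (h \<tau>) = ev i (\<Sum>e\<in>E. ip (h \<tau>) e *\<^sub>R e)" if "\<tau> \<in> S" for \<tau>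
        by (rule arg_cong[OF bspec[OF E(2) h[OF that]]])
      ultimately show "((\<lambda>\<tau>. ev i (h \<tau>)) has_vector_derivative ev i (\<Sum>e\<in>E. ip h' e *\<^sub>R e)) (at t within S)"
        using t(1) by (intro has_vector_derivative_transform[of t S "\<lambda>\<tau>. ev i (h \<tau>)"
            "\<lambda>\<tau>. ev i (\<Sum>e\<in>E. ip (h \<tau>) e *\<^sub>R e)"]) auto
    qed
    then show ?thesis
      using sep[of "h' - (\<Sum>e\<in>E. ip h' e *\<^sub>R e)"] by (simp add: linear_diff[OF lin])
  qed
  show "h' \<in> V"
    using EV by (subst h'_eq) (auto intro!: subspace_sum subspace_scale V)
  show "((\<lambda>\<tau>. l (h \<tau>)) has_real_derivative l h') (at t within S)" if l: "linear_form_on V l"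
  proof -
    have lx: "l x = (\<Sum>e\<in>E. ip x e * l e)" if "x \<in> V" for x
      using linear_form_on_sum[OF V(1) l EV, of "ip x"] bspec[OF E(2) that] by metis
    have "((\<lambda>\<tau>. \<Sum>e\<in>E. ip (h \<tau>) e * l e) has_real_derivative (\<Sum>e\<in>E. ip h' e * l e)) (at t within S)"
      by (intro DERIV_sum DERIV_cmult_right ipd)
    then show ?thesis
      using h lx t(1) \<open>h' \<in> V\<close>
      by (auto intro: has_field_derivative_transform_within[OF _ zero_less_one])
  qed
qed

section \<open>Polynomials and their integrals\<close>

text \<open>Along the line from a point of the open set to an arbitrary point, each component is a polynomial
  in one variable with infinitely many zeros.\<close>

lemma polynomial_function_eq_zero:
  fixes f :: "'a::euclidean_space \<Rightarrow> 'b::euclidean_space"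
  assumes f: "polynomial_function f" and U: "open U" "U \<noteq> {}" and zero: "\<And>x. x \<in> U \<Longrightarrow> f x = 0"
  shows "f = (\<lambda>_. 0)"
proof (rule ext, rule euclidean_eqI)
  fix y :: 'a and b :: 'b
  obtain x where x: "x \<in> U" using U by blast
  define L where "L t = x + t *\<^sub>R (y - x)" for t :: real
  define g where "g = (\<lambda>t. f (L t) \<bullet> b)"
  have L: "polynomial_function L"
    unfolding L_def
    by (intro polynomial_function_add polynomial_function_const polynomial_function_mult polynomial_function_id)
  have "polynomial_function (f \<circ> L)"
    by (rule polynomial_function_compose[OF L f])
  then have "real_polynomial_function ((\<lambda>v. v \<bullet> b) \<circ> (f \<circ> L))"
    unfolding polynomial_function_def using bounded_linear_inner_left by blast
  then have "real_polynomial_function g"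
    by (simp add: g_def o_def)
  then obtain a n where a: "g = (\<lambda>t. \<Sum>i\<le>n. a i * t ^ i)"
    using real_polynomial_function_iff_sum by blast
  have "open (L -` U)"
    unfolding L_def using U(1) by (intro continuous_open_vimage continuous_intros)
  moreover have "0 \<in> L -` U" using x by (simp add: L_def)
  ultimately have "infinite (L -` U)"
    using finite_imp_not_open by blast
  moreover have "L -` U \<subseteq> {t. (\<Sum>i\<le>n. a i * t ^ i) = 0}"
    using zero fun_cong[OF a, symmetric] by (auto simp: g_def)
  ultimately have "\<forall>k\<le>n. a k = 0"
    using polyfun_rootbound_finite[of n a] finite_subset by blast
  then have "g 1 = 0" by (simp add: a)
  then show "f y \<bullet> b = 0 \<bullet> b" by (simp add: g_def L_def)
qed

lemma set_integrable_continuous_compact: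
  fixes f :: "'a::euclidean_space \<Rightarrow> 'b::euclidean_space"
  assumes "compact K" "continuous_on UNIV f"
  shows "set_integrable lborel K f"
  unfolding set_integrable_def
  using borel_integrable_compact[of K f] assms continuous_on_subset by blast

text \<open>The points of the open set where a continuous function does not vanish form an open set; a
  null open set is empty.\<close>

lemma AE_lborel_open_imp_all:
  fixes f :: "'a::euclidean_space \<Rightarrow> real"
  assumes f: "continuous_on UNIV f" and U: "open U" and AE: "AE x in lborel. x \<in> U \<longrightarrow> f x = 0"
    and x: "x \<in> U"
  shows "f x = 0"
proof (rule ccontr)
  assume "f x \<noteq> 0"
  define W where "W = U \<inter> f -` (- {0})"
  have W: "open W"
    unfolding W_def using U f
    by (intro open_Int open_vimage) auto
  have "x \<in> W" using x \<open>f x \<noteq> 0\<close> by (simp add: W_def)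
  have "AE x in lborel. x \<notin> W"
    using AE by eventually_elim (auto simp: W_def)
  then have "W \<in> null_sets lborel"
    using W by (simp add: AE_iff_null_sets)
  then have "negligible W"
    using W negligible_iff_null_sets null_sets_completionI by blast
  then show False using open_not_negligible[OF W] \<open>x \<in> W\<close> by blast
qed

text \<open>This gives the definiteness of the scalar products: a polynomial that vanishes almost everywhere
  on a cell vanishes on its interior, hence everywhere.\<close>

lemma polynomial_function_L2_zero:
  fixes f :: "'a::euclidean_space \<Rightarrow> 'b::euclidean_space"
  assumes f: "polynomial_function f" and K: "compact K" "interior K \<noteq> {}"
    and int: "set_lebesgue_integral lborel K (\<lambda>x. f x \<bullet> f x) = 0"
  shows "f = (\<lambda>_. 0)"
proof -
  have cf: "continuous_on UNIV f"
    using continuous_on_polymonial_function[OF f] .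
  then have c: "continuous_on UNIV (\<lambda>x. f x \<bullet> f x)"
    by (intro continuous_intros)
  have "integrable lborel (\<lambda>x. indicator K x *\<^sub>R (f x \<bullet> f x))"
    using set_integrable_continuous_compact[OF K(1) c] by (simp add: set_integrable_def)
  then have "AE x in lborel. indicator K x *\<^sub>R (f x \<bullet> f x) = 0"
    using int by (subst integral_nonneg_eq_0_iff_AE[symmetric])
      (auto simp: set_lebesgue_integral_def)
  then have AE: "AE x in lborel. x \<in> interior K \<longrightarrow> f x \<bullet> f x = 0"
    by eventually_elim (use interior_subset[of K] in \<open>auto simp: indicator_def\<close>)
  show ?thesis
  proof (rule polynomial_function_eq_zero[OF f open_interior K(2)])
    fix x assume "x \<in> interior K"
    then show "f x = 0"
      using AE_lborel_open_imp_all[OF c open_interior AE] by simp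
  qed
qed

text \<open>The transport field is merely integrable; a continuous factor is bounded on a compact cell.\<close>

lemma set_integrable_inner_continuous:
  fixes b g :: "'a::euclidean_space \<Rightarrow> 'b::euclidean_space"
  assumes K: "compact K" and b: "set_integrable lborel K b" and g: "continuous_on UNIV g"
  shows "set_integrable lborel K (\<lambda>x. g x \<bullet> b x)"
proof -
  have "bounded (g ` K)"
    using K g by (meson compact_continuous_image compact_imp_bounded continuous_on_subset subset_UNIV)
  then obtain B where B: "\<And>x. x \<in> K \<Longrightarrow> norm (g x) \<le> B"
    by (auto simp: bounded_iff)
  have bm: "(\<lambda>x. indicator K x *\<^sub>R b x) \<in> borel_measurable lborel"
    using b by (auto simp: set_integrable_def dest: borel_measurable_integrable)
  have gm: "g \<in> borel_measurable lborel"
    using g by (simp add: borel_measurable_continuous_onI)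
  have "(\<lambda>x. g x \<bullet> (indicator K x *\<^sub>R b x)) \<in> borel_measurable lborel"
    by (rule borel_measurable_inner[OF gm bm])
  then have meas: "set_borel_measurable lborel K (\<lambda>x. g x \<bullet> b x)"
    by (simp add: set_borel_measurable_def)
  have "set_integrable lborel K (\<lambda>x. B *\<^sub>R b x)"
    using b integrable_scaleR_right[of B lborel "\<lambda>x. indicator K x *\<^sub>R b x"]
    by (simp add: set_integrable_def mult.commute)
  then show ?thesis
  proof (rule set_integrable_bound[OF _ meas], intro AE_I2 impI)
    fix x assume "x \<in> K"
    have "norm (g x \<bullet> b x) \<le> norm (g x) * norm (b x)"
      by (simp add: Cauchy_Schwarz_ineq2)
    also have "\<dots> \<le> \<bar>B\<bar> * norm (b x)"
      using B[OF \<open>x \<in> K\<close>] by (intro mult_right_mono) auto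
    finally show "norm (g x \<bullet> b x) \<le> norm (B *\<^sub>R b x)" by simp
  qed
qed

section \<open>Gradient and curl of polynomials\<close>

lemma dx_eq: "(f has_derivative f') (at p) \<Longrightarrow> dx f p = f' (1, 0)"
  and dy_eq: "(f has_derivative f') (at p) \<Longrightarrow> dy f p = f' (0, 1)"
  by (simp_all add: dx_def dy_def frechet_derivative_at[symmetric])

lemma has_derivative_grad:
  assumes "f differentiable (at p)"
  shows "(f has_derivative (\<lambda>h. grad f p \<bullet> h)) (at p)"
proof -
  obtain f' where f': "(f has_derivative f') (at p)"
    using assms by (auto simp: differentiable_def)
  have "f' = (\<lambda>h. grad f p \<bullet> h)"
  proof
    fix h :: pt
    have "f' h = f' (fst h *\<^sub>R (1, 0) + snd h *\<^sub>R (0, 1))" by (cases h) simp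
    also have "\<dots> = fst h * f' (1, 0) + snd h * f' (0, 1)"
      using has_derivative_linear[OF f'] by (simp only: linear_add linear_scale real_scaleR_def)
    also have "\<dots> = grad f p \<bullet> h"
      using dx_eq[OF f'] dy_eq[OF f'] by (simp add: grad_def inner_prod_def)
    finally show "f' h = grad f p \<bullet> h" .
  qed
  with f' show ?thesis by simp
qed

lemma real_polynomial_function_has_grad:
  "real_polynomial_function f \<Longrightarrow> (f has_derivative (\<lambda>h. grad f p \<bullet> h)) (at p)" for f :: "pt \<Rightarrow> real"
  using has_derivative_grad differentiable_at_real_polynomial_function by blast

lemma dx_add: "f differentiable (at p) \<Longrightarrow> g differentiable (at p) \<Longrightarrow> dx (\<lambda>x. f x + g x) p = dx f p + dx g p"
  and dy_add: "f differentiable (at p) \<Longrightarrow> g differentiable (at p) \<Longrightarrow> dy (\<lambda>x. f x + g x) p = dy f p + dy g p"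
  and dx_mult: "f differentiable (at p) \<Longrightarrow> g differentiable (at p) \<Longrightarrow> dx (\<lambda>x. f x * g x) p = f p * dx g p + dx f p * g p"
  and dy_mult: "f differentiable (at p) \<Longrightarrow> g differentiable (at p) \<Longrightarrow> dy (\<lambda>x. f x * g x) p = f p * dy g p + dy f p * g p"
  using dx_eq[OF has_derivative_add[OF has_derivative_grad[of f] has_derivative_grad[of g]]]
    dy_eq[OF has_derivative_add[OF has_derivative_grad[of f] has_derivative_grad[of g]]]
    dx_eq[OF has_derivative_mult[OF has_derivative_grad[of f] has_derivative_grad[of g]]]
    dy_eq[OF has_derivative_mult[OF has_derivative_grad[of f] has_derivative_grad[of g]]]
  by (simp_all add: grad_def inner_prod_def)

lemma dx_const: "dx (\<lambda>x. c) p = 0" and dy_const: "dy (\<lambda>x. c) p = 0"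
  using dx_eq[OF has_derivative_const] dy_eq[OF has_derivative_const] by auto

text \<open>Mixed partial derivatives commute. For polynomials this follows from the sum and product rules by
  structural induction, together with the fact that partial derivatives are again polynomials.\<close>

lemma real_polynomial_function_partials:
  assumes "real_polynomial_function f"
  shows "real_polynomial_function (dx f) \<and> real_polynomial_function (dy f) \<and> dx (dy f) = dy (dx f)"
  using assms
proof (induction f rule: real_polynomial_function.induct)
  case (linear f)
  then have "(f has_derivative f) (at p)" for p
    by (rule bounded_linear_imp_has_derivative)
  then have eq: "dx f = (\<lambda>_. f (1, 0))" "dy f = (\<lambda>_. f (0, 1))"
    by (simp_all add: fun_eq_iff dx_eq dy_eq)
  show ?case
    unfolding eq by (simp add: fun_eq_iff dx_const dy_const real_polynomial_function.intros(2))
next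
  case (const c)
  have "dx (\<lambda>x. c) = (\<lambda>_. 0)" "dy (\<lambda>x. c) = (\<lambda>_. 0)"
    by (simp_all add: fun_eq_iff dx_const dy_const)
  then show ?case by (simp add: fun_eq_iff dx_const dy_const real_polynomial_function.intros(2))
next
  case (add f g)
  note d = differentiable_at_real_polynomial_function
  have eq: "dx (\<lambda>x. f x + g x) = (\<lambda>x. dx f x + dx g x)" "dy (\<lambda>x. f x + g x) = (\<lambda>x. dy f x + dy g x)"
    using add.hyps by (auto simp: fun_eq_iff d intro!: dx_add dy_add)
  have "dx (\<lambda>x. dy f x + dy g x) = dy (\<lambda>x. dx f x + dx g x)"
    using add.IH by (auto simp: fun_eq_iff d dx_add dy_add)
  then show ?case unfolding eq using add.IH by auto
next
  case (mult f g)
  note d = differentiable_at_real_polynomial_function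
  have eq: "dx (\<lambda>x. f x * g x) = (\<lambda>x. f x * dx g x + dx f x * g x)"
      "dy (\<lambda>x. f x * g x) = (\<lambda>x. f x * dy g x + dy f x * g x)"
    using mult.hyps by (auto simp: fun_eq_iff d intro!: dx_mult dy_mult)
  have "dx (\<lambda>x. f x * dy g x + dy f x * g x) p = dy (\<lambda>x. f x * dx g x + dx f x * g x) p" for p
  proof -
    have "dx (\<lambda>x. f x * dy g x + dy f x * g x) p
        = (f p * dx (dy g) p + dx f p * dy g p) + (dy f p * dx g p + dx (dy f) p * g p)"
      using mult by (subst dx_add) (auto simp: d dx_mult)
    moreover have "dy (\<lambda>x. f x * dx g x + dx f x * g x) p
        = (f p * dy (dx g) p + dy f p * dx g p) + (dx f p * dy g p + dy (dx f) p * g p)"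
      using mult by (subst dy_add) (auto simp: d dy_mult)
    ultimately show ?thesis using mult.IH by simp
  qed
  then show ?case unfolding eq using mult by (auto simp: fun_eq_iff)
qed

lemma perp_div_grad:
  assumes "real_polynomial_function f"
  shows "perp_div (grad f) p = 0"
proof -
  have "fst \<circ> grad f = dx f" "snd \<circ> grad f = dy f"
    by (auto simp: grad_def fun_eq_iff)
  then show ?thesis
    using real_polynomial_function_partials[OF assms] by (simp add: perp_div_def)
qed

lemma polynomial_function_fst: "polynomial_function u \<Longrightarrow> real_polynomial_function (fst \<circ> u)"
  and polynomial_function_snd: "polynomial_function u \<Longrightarrow> real_polynomial_function (snd \<circ> u)"
  for u :: "pt \<Rightarrow> pt"
  unfolding polynomial_function_def using bounded_linear_fst bounded_linear_snd by blast+

lemma polynomial_function_Pair: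
  assumes f: "polynomial_function f" and g: "polynomial_function g"
  shows "polynomial_function (\<lambda>x. (f x :: real, g x :: real))"
proof -
  have "polynomial_function (\<lambda>x. f x *\<^sub>R (1, 0) + g x *\<^sub>R (0, 1) :: pt)"
    using f g by (intro polynomial_function_add polynomial_function_mult) auto
  then show ?thesis by simp
qed

lemma polynomial_function_perp: "polynomial_function u \<Longrightarrow> polynomial_function (\<lambda>x. perp (u x))"
  for u :: "pt \<Rightarrow> pt"
proof -
  have "linear perp" by (rule linearI) (auto simp: perp_def)
  then show "polynomial_function u \<Longrightarrow> polynomial_function (\<lambda>x. perp (u x))"
    using polynomial_function_compose[of u perp]
    by (simp add: o_def linear_linear polynomial_function_bounded_linear)
qed

text \<open>For nonzero \<open>d\<close> in the plane the orthogonal complement of \<open>perp d\<close> is the line spanned by \<open>d\<close>.\<close>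

lemma inner_tangent_normal:
  fixes v w d :: pt
  assumes "d \<noteq> 0" "v \<bullet> d = 0" "w \<bullet> perp d = 0"
  shows "v \<bullet> w = 0"
proof -
  obtain v1 v2 w1 w2 d1 d2 where eq: "v = (v1, v2)" "w = (w1, w2)" "d = (d1, d2)"
    by (metis surj_pair)
  have 1: "v1 * d1 + v2 * d2 = 0" "w2 * d1 = w1 * d2" and d: "d1 \<noteq> 0 \<or> d2 \<noteq> 0"
    using assms by (auto simp: eq perp_def inner_prod_def zero_prod_def)
  have "d1 * (v1 * w1 + v2 * w2) = (v1 * d1 + v2 * d2) * w1"
    using 1(2) by algebra
  moreover have "d2 * (v1 * w1 + v2 * w2) = (v1 * d1 + v2 * d2) * w2"
    using 1(2) by algebra
  ultimately have "v1 * w1 + v2 * w2 = 0" using 1(1) d by auto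
  then show ?thesis by (simp add: eq inner_prod_def)
qed

lemma inner_perp_perp: "perp v \<bullet> perp w = v \<bullet> w"
  by (simp add: perp_def inner_prod_def)

lemma perp_diff: "perp (v - w) = perp v - perp w"
  by (simp add: perp_def)

lemma perp_scaleR: "perp (c *\<^sub>R v) = c *\<^sub>R perp v"
  by (simp add: perp_def)

lemma perp_add: "perp (v + w) = perp v + perp w"
  by (simp add: perp_def)

lemma dx_scale: "f differentiable (at p) \<Longrightarrow> dx (\<lambda>x. c * f x) p = c * dx f p"
  and dy_scale: "f differentiable (at p) \<Longrightarrow> dy (\<lambda>x. c * f x) p = c * dy f p"
  using dx_mult[of "\<lambda>_. c" p f] dy_mult[of "\<lambda>_. c" p f] by (simp_all add: dx_const dy_const)

section \<open>Polygonal cells\<close>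

lemma connected_component_set_translation:
  fixes z :: "'a::real_normed_vector"
  shows "connected_component_set ((+) z ` A) (z + x) = (+) z ` connected_component_set A x"
proof -
  have sub: "(+) z ` connected_component_set A x \<subseteq> connected_component_set ((+) z ` A) (z + x)"
    for z x :: 'a and A
  proof clarsimp
    fix y assume "connected_component A x y"
    then obtain T where T: "connected T" "T \<subseteq> A" "x \<in> T" "y \<in> T"
      by (auto simp: connected_component_def)
    then have "connected ((+) z ` T)"
      by (intro connected_continuous_image continuous_intros)
    then show "connected_component ((+) z ` A) (z + x) (z + y)"
      using T unfolding connected_component_def by blast
  qed
  have "(+) (-z) ` connected_component_set ((+) z ` A) (z + x) \<subseteq> connected_component_set A x"
    using sub[of "-z" "(+) z ` A" "z + x"] by (simp add: image_image)
  then have "(+) z ` (+) (-z) ` connected_component_set ((+) z ` A) (z + x) \<subseteq> (+) z ` connected_component_set A x"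
    by (rule image_mono)
  then have "connected_component_set ((+) z ` A) (z + x) \<subseteq> (+) z ` connected_component_set A x"
    by (simp add: image_image)
  with sub show ?thesis by blast
qed

lemma inside_translation:
  fixes z :: "'a::real_normed_vector"
  shows "inside ((+) z ` S) = (+) z ` inside S"
proof -
  have sub: "(+) z ` inside S \<subseteq> inside ((+) z ` S)" for z :: 'a and S
  proof clarsimp
    fix x assume x: "x \<in> inside S"
    \<comment> \<open>a translation is a bijection of the whole space, so it commutes with complements\<close>
    have "- (+) z ` S = (+) z ` (- S)"
      by (rule bij_image_Compl_eq[symmetric]) (simp add: bij_plus)
    then show "z + x \<in> inside ((+) z ` S)"
      using x by (auto simp: inside_def connected_component_set_translation bounded_translation)
  qed
  have "(+) (-z) ` inside ((+) z ` S) \<subseteq> inside S"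
    using sub[of "-z" "(+) z ` S"] by (simp add: image_image)
  then have "(+) z ` (+) (-z) ` inside ((+) z ` S) \<subseteq> (+) z ` inside S"
    by (rule image_mono)
  then have "inside ((+) z ` S) \<subseteq> (+) z ` inside S"
    by (simp add: image_image)
  with sub show ?thesis by blast
qed

lemma polyline_map:
  "vs \<noteq> [] \<Longrightarrow> polyline (map ((+) z) vs) = (+) z \<circ> polyline vs"
proof (induction vs rule: polyline.induct)
  case (4 a b c vs)
  then show ?case
    by (simp add: path_compose_join) (auto simp: linepath_def fun_eq_iff joinpaths_def algebra_simps)
qed (auto simp: linepath_def fun_eq_iff algebra_simps)

lemma region_shift:
  assumes "vs \<noteq> []"
  shows "region (shift z vs) = (+) z ` region vs"
proof -
  have "shift z vs @ [hd (shift z vs)] = map ((+) z) (vs @ [hd vs])"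
    using assms by (simp add: shift_def list.map_sel(1))
  then have "polygon_path (shift z vs) = (+) z \<circ> polygon_path vs"
    unfolding polygon_path_def using polyline_map[of "vs @ [hd vs]" z] by (metis append_is_Nil_conv not_Cons_self2)
  then show ?thesis
    by (simp add: region_def path_image_compose inside_translation image_Un)
qed

lemma pathstart_polyline: "vs \<noteq> [] \<Longrightarrow> pathstart (polyline vs) = hd vs"
  by (induction vs rule: polyline.induct) auto

lemma pathfinish_polyline: "vs \<noteq> [] \<Longrightarrow> pathfinish (polyline vs) = last vs"
  by (induction vs rule: polyline.induct) auto

lemma segment_subset_polyline:
  "Suc i < length vs \<Longrightarrow> closed_segment (vs ! i) (vs ! Suc i) \<subseteq> path_image (polyline vs)"
proof (induction vs arbitrary: i rule: polyline.induct)
  case (4 a b c vs)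
  have "path_image (polyline (a # b # c # vs)) = closed_segment a b \<union> path_image (polyline (b # c # vs))"
    by (simp add: path_image_join pathstart_polyline)
  then show ?case
    using 4 by (cases i) auto
qed auto

lemma polygon_side_subset:
  assumes "E \<in> polygon_sides vs"
  shows "E \<subseteq> region vs"
proof -
  obtain i where i: "i < length vs" "E = closed_segment (vs ! i) (vs ! (Suc i mod length vs))"
    using assms by (auto simp: polygon_sides_def)
  have "(vs @ [hd vs]) ! Suc i = vs ! (Suc i mod length vs)"
    using i(1) by (cases "Suc i = length vs") (auto simp: nth_append intro!: hd_conv_nth)
  moreover have "(vs @ [hd vs]) ! i = vs ! i"
    using i(1) by (simp add: nth_append)
  ultimately have "E \<subseteq> path_image (polygon_path vs)"
    using segment_subset_polyline[of i "vs @ [hd vs]"] i by (simp add: polygon_path_def)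
  then show ?thesis by (auto simp: region_def)
qed

text \<open>By the Jordan--Brouwer separation theorem a simple closed curve disconnects the plane, whereas its
  outside is connected; so it has a nonempty, and open, inside. The separation theorem needs
  a homeomorphism with a sphere of the plane itself, reached through the unit circle of the
  complex numbers.\<close>

lemma polygon_region:
  assumes "is_polygon n vs" "n \<noteq> 0"
  shows compact_region: "compact (region vs)" and interior_region: "interior (region vs) \<noteq> {}"
proof -
  let ?g = "polygon_path vs"
  have vs: "vs \<noteq> []" and sp: "simple_path ?g"
    using assms by (auto simp: is_polygon_def)
  have loop: "pathfinish ?g = pathstart ?g"
    using vs by (simp add: polygon_path_def pathstart_polyline pathfinish_polyline)
  have p: "path ?g" using sp by (rule simple_path_imp_path)
  have cl: "closed (path_image ?g)" and bd: "bounded (path_image ?g)"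
    using p by (auto simp: closed_path_image bounded_path_image)
  have "closed (region vs)"
    unfolding region_def by (rule closed_path_image_Un_inside[OF p])
  moreover have "bounded (region vs)"
    unfolding region_def using bd bounded_inside by auto
  ultimately show "compact (region vs)"
    by (simp add: compact_eq_bounded_closed)
  have hom: "path_image ?g homeomorphic sphere (0::pt) 1"
  proof (rule homeomorphic_trans)
    show "path_image ?g homeomorphic sphere (0::complex) 1"
      by (rule homeomorphic_simple_path_image_circle[OF sp loop]) simp
    show "sphere (0::complex) 1 homeomorphic sphere (0::pt) 1"
      by (rule homeomorphic_spheres_gen) auto
  qed
  have "inside (path_image ?g) \<noteq> {}"
  proof
    assume "inside (path_image ?g) = {}"
    then have "outside (path_image ?g) = - path_image ?g"
      using inside_Un_outside[of "path_image ?g"] by simp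
    then have "connected (- path_image ?g)"
      using connected_outside[OF bd] by simp
    then show False
      using Jordan_Brouwer_separation[OF hom] by simp
  qed
  then show "interior (region vs) \<noteq> {}"
    using interior_maximal[OF _ open_inside[OF cl], of "region vs"] by (auto simp: region_def)
qed

section \<open>Spaces of piecewise polynomials\<close>

text \<open>The three properties of the local spaces on which everything below rests; they are preserved
  by the constructions from which the families of elements are built.\<close>

definition poly_space :: "('a::euclidean_space \<Rightarrow> 'b::euclidean_space) set \<Rightarrow> bool" where
  "poly_space V \<longleftrightarrow> subspace V \<and> finite_dim V \<and> (\<forall>f\<in>V. polynomial_function f)"

lemma poly_space_combinations:
  assumes "finite I" and "\<And>i. i \<in> I \<Longrightarrow> polynomial_function (m i)"
  shows "poly_space {\<lambda>p. \<Sum>i\<in>I. c i *\<^sub>R m i p | c. True}" (is "poly_space ?V")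
proof -
  have eq: "?V = {\<Sum>i\<in>I. c i *\<^sub>R m i | c. True}"
    by (auto simp: fun_eq_iff)
  have "subspace ?V"
  proof (rule subspaceI)
    show "0 \<in> ?V" by (auto simp: fun_eq_iff intro!: exI[of _ "\<lambda>_. 0"])
    fix f g assume "f \<in> ?V" "g \<in> ?V"
    then obtain c d where "f = (\<lambda>p. \<Sum>i\<in>I. c i *\<^sub>R m i p)" "g = (\<lambda>p. \<Sum>i\<in>I. d i *\<^sub>R m i p)" by auto
    then show "f + g \<in> ?V"
      by (auto simp: fun_eq_iff scaleR_add_left sum.distrib intro!: exI[of _ "\<lambda>i. c i + d i"])
  next
    fix f r assume "f \<in> ?V"
    then obtain c where "f = (\<lambda>p. \<Sum>i\<in>I. c i *\<^sub>R m i p)" by auto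
    then show "r *\<^sub>R f \<in> ?V"
      by (auto simp: fun_eq_iff scaleR_sum_right intro!: exI[of _ "\<lambda>i. r * c i"])
  qed
  moreover have "?V \<subseteq> span (m ` I)"
    unfolding eq by (auto intro!: span_sum span_scale intro: span_base)
  then have "finite_dim ?V"
    using finite_dim_span[of "m ` I"] assms(1) finite_dim_subset by blast
  moreover have "\<forall>f\<in>?V. polynomial_function f"
    using assms by (auto intro!: polynomial_function_sum polynomial_function_cmul)
  ultimately show ?thesis by (simp add: poly_space_def)
qed

lemma poly_space_polys:
  assumes "finite I"
  shows "poly_space (polys I)"
proof -
  let ?m = "\<lambda>(a, b) p. fst p ^ a * snd p ^ b :: real"
  have "polys I = {\<lambda>p. \<Sum>i\<in>I. c i *\<^sub>R ?m i p | c. True}" (is "_ = ?V")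
  proof (intro set_eqI iffI)
    fix f assume "f \<in> polys I"
    then obtain c where "f = (\<lambda>p. \<Sum>(a, b) \<in> I. c a b * fst p ^ a * snd p ^ b)"
      by (auto simp: polys_def)
    then show "f \<in> ?V"
      by (auto simp: fun_eq_iff case_prod_unfold mult.assoc intro!: exI[of _ "\<lambda>i. c (fst i) (snd i)"])
  next
    fix f assume "f \<in> ?V"
    then obtain c where "f = (\<lambda>p. \<Sum>i\<in>I. c i *\<^sub>R ?m i p)" by auto
    then show "f \<in> polys I"
      by (auto simp: polys_def fun_eq_iff case_prod_unfold mult.assoc intro!: exI[of _ "\<lambda>a b. c (a, b)"])
  qed
  moreover have "poly_space ?V"
  proof (rule poly_space_combinations[OF assms])
    fix i assume "i \<in> I"
    have "real_polynomial_function (fst :: pt \<Rightarrow> real)" "real_polynomial_function (snd :: pt \<Rightarrow> real)"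
      by (auto intro: bounded_linear_fst bounded_linear_snd)
    then have "real_polynomial_function (\<lambda>p :: pt. fst p ^ fst i * snd p ^ snd i)"
      by (intro real_polynomial_function.intros(4) real_polynomial_function_power)
    then show "polynomial_function (?m i)"
      by (simp add: case_prod_unfold real_polynomial_function_eq)
  qed
  ultimately show ?thesis by simp
qed

lemma poly_space_PP: "poly_space (PP m)"
proof -
  have "{(a, b). int a + int b \<le> m} \<subseteq> {..nat m} \<times> {..nat m}" by auto
  then have "finite {(a, b). int a + int b \<le> m}" by (rule finite_subset) auto
  then show ?thesis unfolding PP_def by (rule poly_space_polys)
qed

lemma poly_space_PP_hom: "poly_space (PP_hom m)"
proof -
  have "{(a, b). a + b = m} \<subseteq> {..m} \<times> {..m}" by auto
  then have "finite {(a, b). a + b = m}" by (rule finite_subset) auto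
  then show ?thesis unfolding PP_hom_def by (rule poly_space_polys)
qed

lemma poly_space_QQ: "poly_space (QQ i j)"
proof -
  have "{(a, b). int a \<le> i \<and> int b \<le> j} \<subseteq> {..nat i} \<times> {..nat j}" by auto
  then have "finite {(a, b). int a \<le> i \<and> int b \<le> j}" by (rule finite_subset) auto
  then show ?thesis unfolding QQ_def by (rule poly_space_polys)
qed

lemma poly_space_image:
  assumes V: "poly_space V" and h: "linear h" and p: "\<And>f. f \<in> V \<Longrightarrow> polynomial_function (h f)"
  shows "poly_space (h ` V)"
  using assms linear_subspace_image[OF h] finite_dim_linear_image[OF h]
  by (auto simp: poly_space_def)

lemma poly_space_fsum:
  assumes "poly_space V" "poly_space W"
  shows "poly_space (fsum V W)"
proof -
  have "fsum V W = {f + g | f g. f \<in> V \<and> g \<in> W}"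
    by (auto simp: fsum_def plus_fun_def)
  then show ?thesis
    using assms subspace_sums[of V W] finite_dim_sum_set[of V W]
    by (auto simp: poly_space_def plus_fun_def intro!: polynomial_function_add)
qed

lemma poly_space_fprod:
  assumes V: "poly_space V" and W: "poly_space W"
  shows "poly_space (fprod V W)"
proof -
  define h1 where "h1 f = (\<lambda>p :: pt. (f p, 0 :: real))" for f :: "pt \<Rightarrow> real"
  define h2 where "h2 f = (\<lambda>p :: pt. (0 :: real, f p))" for f :: "pt \<Rightarrow> real"
  have "fprod V W = fsum (h1 ` V) (h2 ` W)"
  proof -
    have "fsum (h1 ` V) (h2 ` W) = {\<lambda>p. h1 f p + h2 g p | f g. f \<in> V \<and> g \<in> W}"
      unfolding fsum_def by blast
    then show ?thesis by (simp add: fprod_def h1_def h2_def)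
  qed
  moreover have "linear h1" "linear h2"
    by (auto intro!: linearI simp: h1_def h2_def fun_eq_iff)
  moreover have "polynomial_function (h1 f)" if "f \<in> V" for f
    using V that by (auto simp: h1_def poly_space_def intro!: polynomial_function_Pair)
  moreover have "polynomial_function (h2 f)" if "f \<in> W" for f
    using W that by (auto simp: h2_def poly_space_def intro!: polynomial_function_Pair)
  ultimately show ?thesis
    using V W by (simp add: poly_space_fsum poly_space_image)
qed

lemma poly_space_A_loc: "poly_space (A_loc F k)"
  by (cases F) (simp_all add: poly_space_PP poly_space_QQ)

lemma poly_space_B_loc: "poly_space (B_loc F k)"
proof -
  define h where "h q = (\<lambda>p. q p *\<^sub>R perp p)" for q :: "pt \<Rightarrow> real"
  have "linear h" by (auto intro!: linearI simp: h_def fun_eq_iff scaleR_add_left)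
  then have "poly_space (h ` PP_hom k)"
    using poly_space_PP_hom[of k] polynomial_function_perp[OF polynomial_function_id]
    by (intro poly_space_image) (auto simp: poly_space_def h_def intro!: polynomial_function_mult)
  moreover have "h ` PP_hom k = {\<lambda>p. q p *\<^sub>R perp p | q. q \<in> PP_hom k}"
    by (auto simp: h_def)
  moreover have "poly_space {\<lambda>p :: pt. c *\<^sub>R (fst p ^ k * snd p ^ (k + 1), fst p ^ (k + 1) * snd p ^ k) | c :: real. True}"
    (is "poly_space ?E")
  proof -
    let ?m = "\<lambda>p :: pt. (fst p ^ k * snd p ^ (k + 1), fst p ^ (k + 1) * snd p ^ k)"
    have "real_polynomial_function (fst :: pt \<Rightarrow> real)" "real_polynomial_function (snd :: pt \<Rightarrow> real)"
      by (auto intro: bounded_linear_fst bounded_linear_snd)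
    then have "polynomial_function ?m"
      by (intro polynomial_function_Pair)
        (auto simp: real_polynomial_function_eq[symmetric] simp del: power_Suc
          intro!: real_polynomial_function.intros(4) real_polynomial_function_power)
    then have "poly_space {\<lambda>p. \<Sum>i\<in>{()}. c i *\<^sub>R ?m p | c. True}"
      by (intro poly_space_combinations) auto
    moreover have "{\<lambda>p. \<Sum>i\<in>{()}. c i *\<^sub>R ?m p | c. True} = ?E"
    proof (intro set_eqI iffI)
      fix f assume "f \<in> ?E"
      then obtain c :: real where "f = (\<lambda>p. c *\<^sub>R ?m p)" by auto
      then show "f \<in> {\<lambda>p. \<Sum>i\<in>{()}. c i *\<^sub>R ?m p | c. True}"
        by (intro CollectI exI[of _ "\<lambda>_. c"]) simp
    qed auto
    ultimately show ?thesis by simp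
  qed
  ultimately show ?thesis
    by (cases F) (simp_all add: poly_space_PP poly_space_QQ poly_space_fsum poly_space_fprod)
qed

lemma poly_space_C_loc: "poly_space (C_loc F k)"
  by (cases F) (simp_all add: poly_space_PP poly_space_QQ poly_space_fsum)

definition side_polys :: "nat \<Rightarrow> (real \<Rightarrow> real) set" where
  "side_polys k = {poly p | p. degree p \<le> k}"

lemma poly_space_side_polys: "poly_space (side_polys k)"
proof -
  have "side_polys k = {\<lambda>x. \<Sum>i\<in>{..k}. c i *\<^sub>R x ^ i | c. True}"
  proof (intro set_eqI iffI)
    fix f assume "f \<in> side_polys k"
    then obtain p where p: "degree p \<le> k" "f = poly p" by (auto simp: side_polys_def)
    then have "f = (\<lambda>x. \<Sum>i\<in>{..k}. coeff p i *\<^sub>R x ^ i)"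
      by (auto simp: fun_eq_iff poly_altdef intro!: le_degree sum.mono_neutral_left)
    then show "f \<in> {\<lambda>x. \<Sum>i\<in>{..k}. c i *\<^sub>R x ^ i | c. True}" by blast
  next
    fix f :: "real \<Rightarrow> real" assume "f \<in> {\<lambda>x. \<Sum>i\<in>{..k}. c i *\<^sub>R x ^ i | c. True}"
    then obtain c where "f = (\<lambda>x. \<Sum>i\<in>{..k}. c i *\<^sub>R x ^ i)" by auto
    then have "f = poly (\<Sum>i\<le>k. monom (c i) i)"
      by (auto simp: fun_eq_iff poly_sum poly_monom)
    moreover have "degree (\<Sum>i\<le>k. monom (c i) i) \<le> k"
      by (rule degree_sum_le) (auto intro: order_trans[OF degree_monom_le])
    ultimately show "f \<in> side_polys k" by (auto simp: side_polys_def)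
  qed
  then show ?thesis
    by (simp only:) (rule poly_space_combinations; auto simp: real_polynomial_function_eq[symmetric]
        intro!: real_polynomial_function_power bounded_linear_ident)
qed

text \<open>Fields that are independent from cell to cell, normalised to vanish at irrelevant indices;
  without the normalisation an \<open>L\<^sup>2\<close> product would not be definite.\<close>

definition families :: "'i set \<Rightarrow> 'v::real_vector set \<Rightarrow> ('i \<Rightarrow> 'v) set" where
  "families I V = {u. (\<forall>i\<in>I. u i \<in> V) \<and> (\<forall>i. i \<notin> I \<longrightarrow> u i = 0)}"

lemma subspace_families: "subspace V \<Longrightarrow> subspace (families I V)"
  by (auto simp: subspace_def families_def)

lemma finite_dim_families:
  assumes "finite I" "finite_dim V"
  shows "finite_dim (families I V)"
proof -
  obtain B where B: "finite B" "V \<subseteq> span B" using assms(2) by (auto simp: finite_dim_def)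
  define s where "s i v = (\<lambda>j. if j = i then v else 0)" for i :: 'a and v :: 'b
  have lin: "linear (s i)" for i
    by (auto intro!: linearI simp: s_def fun_eq_iff)
  have "families I V \<subseteq> span (\<Union>i\<in>I. s i ` B)"
  proof
    fix u assume u: "u \<in> families I V"
    have "u = (\<Sum>i\<in>I. s i (u i))"
    proof
      fix j
      have "(\<Sum>i\<in>I. s i (u i) j) = (\<Sum>i\<in>I. if j = i then u j else 0)"
        by (intro sum.cong) (auto simp: s_def)
      then show "u j = (\<Sum>i\<in>I. s i (u i)) j"
        using assms(1) u by (simp add: families_def)
    qed
    moreover have "s i (u i) \<in> span (\<Union>i\<in>I. s i ` B)" if i: "i \<in> I" for i
    proof -
      have "s i (u i) \<in> s i ` span B"
        using u i B(2) by (auto simp: families_def)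
      also have "\<dots> = span (s i ` B)" by (simp add: linear_span_image[OF lin])
      also have "\<dots> \<subseteq> span (\<Union>i\<in>I. s i ` B)" using i by (intro span_mono) auto
      finally show ?thesis .
    qed
    ultimately show "u \<in> span (\<Union>i\<in>I. s i ` B)"
      by (metis (no_types, lifting) span_sum)
  qed
  then show ?thesis
    by (rule finite_dim_subset[rotated]) (use assms(1) B(1) in \<open>auto intro!: finite_dim_span\<close>)
qed

lemma set_integral_inner_add_scale:
  fixes f g h :: "'a::euclidean_space \<Rightarrow> 'b::euclidean_space"
  assumes "compact K" "continuous_on UNIV f" "continuous_on UNIV g" "continuous_on UNIV h"
  shows "(LINT x:K|lborel. (f x + g x) \<bullet> h x) = (LINT x:K|lborel. f x \<bullet> h x) + (LINT x:K|lborel. g x \<bullet> h x)"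
    and "(LINT x:K|lborel. (c *\<^sub>R f x) \<bullet> h x) = c * (LINT x:K|lborel. f x \<bullet> h x)"
proof -
  have "set_integrable lborel K (\<lambda>x. f x \<bullet> h x)" "set_integrable lborel K (\<lambda>x. g x \<bullet> h x)"
    by (intro set_integrable_continuous_compact continuous_intros assms)+
  then show "(LINT x:K|lborel. (f x + g x) \<bullet> h x) = (LINT x:K|lborel. f x \<bullet> h x) + (LINT x:K|lborel. g x \<bullet> h x)"
    by (simp add: inner_add_left set_integral_add)
  show "(LINT x:K|lborel. (c *\<^sub>R f x) \<bullet> h x) = c * (LINT x:K|lborel. f x \<bullet> h x)"
    by simp
qed

lemma set_integral_lborel_nonneg:
  fixes f :: "'a::euclidean_space \<Rightarrow> real"
  assumes "\<And>x. 0 \<le> f x"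
  shows "0 \<le> (LINT x:K|lborel. f x)"
  unfolding set_lebesgue_integral_def using assms by (intro integral_nonneg_AE) auto

text \<open>One statement for both kinds of piecewise spaces: on cells the weight is \<open>1\<close>, and on sides it
  is the length, the density of arc length in the affine parameter on \<open>{0..1}\<close>.\<close>

lemma inner_space_families:
  fixes V :: "('a::euclidean_space \<Rightarrow> 'b::euclidean_space) set" and K :: "'i \<Rightarrow> 'a set"
  assumes I: "finite I" and V: "poly_space V"
    and K: "\<And>i. i \<in> I \<Longrightarrow> compact (K i)" "\<And>i. i \<in> I \<Longrightarrow> interior (K i) \<noteq> {}"
    and w: "\<And>i. i \<in> I \<Longrightarrow> 0 < w i"
  shows "inner_space_on (families I V) (\<lambda>u v. \<Sum>i\<in>I. w i * (LINT x:K i|lborel. u i x \<bullet> v i x))"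
proof
  have cont: "continuous_on UNIV (u i)" if "u \<in> families I V" "i \<in> I" for u i
    using that V by (auto simp: families_def poly_space_def intro!: continuous_on_polymonial_function)
  show "subspace (families I V)" "finite_dim (families I V)"
    using V I by (simp_all add: poly_space_def subspace_families finite_dim_families)
  show "linear_form_on (families I V) (\<lambda>x. \<Sum>i\<in>I. w i * (LINT xa:K i|lborel. x i xa \<bullet> y i xa))"
    if y: "y \<in> families I V" for y
    unfolding linear_form_on_def
  proof (intro conjI ballI allI)
    fix u v assume uv: "u \<in> families I V" "v \<in> families I V"
    show "(\<Sum>i\<in>I. w i * (LINT x:K i|lborel. (u + v) i x \<bullet> y i x)) =
        (\<Sum>i\<in>I. w i * (LINT x:K i|lborel. u i x \<bullet> y i x)) + (\<Sum>i\<in>I. w i * (LINT x:K i|lborel. v i x \<bullet> y i x))"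
      using uv y by (simp add: set_integral_inner_add_scale K cont sum.distrib distrib_left)
  next
    fix u c assume "u \<in> families I V"
    show "(\<Sum>i\<in>I. w i * (LINT x:K i|lborel. (c *\<^sub>R u) i x \<bullet> y i x)) =
        c * (\<Sum>i\<in>I. w i * (LINT x:K i|lborel. u i x \<bullet> y i x))"
      by (simp add: sum_distrib_left mult.left_commute)
  qed
  show "(\<Sum>i\<in>I. w i * (LINT xa:K i|lborel. x i xa \<bullet> y i xa)) =
      (\<Sum>i\<in>I. w i * (LINT xa:K i|lborel. y i xa \<bullet> x i xa))" for x y
    by (simp add: inner_commute)
  show nonneg: "0 \<le> (\<Sum>i\<in>I. w i * (LINT xa:K i|lborel. x i xa \<bullet> x i xa))" for x
    using w by (intro sum_nonneg mult_nonneg_nonneg set_integral_lborel_nonneg) (auto simp: less_imp_le)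
  show "u = 0" if u: "u \<in> families I V" and 0: "(\<Sum>i\<in>I. w i * (LINT x:K i|lborel. u i x \<bullet> u i x)) = 0" for u
  proof
    fix i
    show "u i = 0 i"
    proof (cases "i \<in> I")
      case True
      have "\<forall>i\<in>I. w i * (LINT x:K i|lborel. u i x \<bullet> u i x) = 0"
        using 0 w by (subst (asm) sum_nonneg_eq_0_iff[OF I])
          (auto intro!: mult_nonneg_nonneg set_integral_lborel_nonneg simp: less_imp_le)
      then have "(LINT x:K i|lborel. u i x \<bullet> u i x) = 0"
        using True w[OF True] by fastforce
      then have "u i = (\<lambda>_. 0)"
        using True u V by (intro polynomial_function_L2_zero[OF _ K(1,2)]) (auto simp: families_def poly_space_def)
      then show ?thesis by (simp add: fun_eq_iff)
    qed (use u in \<open>simp add: families_def\<close>)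
  qed
qed

lemma inner_space_Times:
  assumes "inner_space_on V ip" "inner_space_on W jp"
  shows "inner_space_on (V \<times> W) (\<lambda>x y. ip (fst x) (fst y) + jp (snd x) (snd y))"
proof -
  interpret V: inner_space_on V ip by fact
  interpret W: inner_space_on W jp by fact
  show ?thesis
  proof
    show "subspace (V \<times> W)" by (intro subspace_Times V.subspace W.subspace)
    have "linear (\<lambda>x. (x, 0 :: 'b))" "linear (\<lambda>y. (0 :: 'a, y))" by (auto intro!: linearI)
    then have "finite_dim ((\<lambda>x. (x, 0 :: 'b)) ` V)" "finite_dim ((\<lambda>y. (0 :: 'a, y)) ` W)"
      using finite_dim_linear_image V.finite_dim W.finite_dim by blast+
    then have "finite_dim {x + y | x y. x \<in> (\<lambda>x. (x, 0 :: 'b)) ` V \<and> y \<in> (\<lambda>y. (0 :: 'a, y)) ` W}"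
      by (rule finite_dim_sum_set)
    then show "finite_dim (V \<times> W)"
      by (rule finite_dim_subset) force
    show "linear_form_on (V \<times> W) (\<lambda>x. ip (fst x) (fst y) + jp (snd x) (snd y))" if "y \<in> V \<times> W" for y
      using that V.linear_form[of "fst y"] W.linear_form[of "snd y"]
      by (auto simp: linear_form_on_def algebra_simps)
    show "ip (fst x) (fst y) + jp (snd x) (snd y) = ip (fst y) (fst x) + jp (snd y) (snd x)"
      if "x \<in> V \<times> W" "y \<in> V \<times> W" for x y
      using that V.sym W.sym by auto
    show "0 \<le> ip (fst x) (fst x) + jp (snd x) (snd x)" if "x \<in> V \<times> W" for x
      using that V.nonneg W.nonneg by auto
    show "x = 0" if "x \<in> V \<times> W" "ip (fst x) (fst x) + jp (snd x) (snd x) = 0" for x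
      using that V.nonneg[of "fst x"] W.nonneg[of "snd x"] V.definite[of "fst x"] W.definite[of "snd x"]
      by (auto simp: prod_eq_iff add_nonneg_eq_0_iff)
  qed
qed

section \<open>Linear differential systems\<close>

text \<open>Gronwall's argument: \<open>N = (\<Sum>e\<in>E. (y e)\<^sup>2)\<close> satisfies \<open>N' \<le> K * N\<close>, so \<open>N s * exp (- K * s)\<close> does not
  increase, and it starts at \<open>0\<close>.\<close>

lemma linear_ode_zero:
  fixes y :: "'e \<Rightarrow> real \<Rightarrow> real"
  assumes E: "finite E" and y0: "\<And>e. e \<in> E \<Longrightarrow> y e 0 = 0"
    and deriv: "\<And>e t. e \<in> E \<Longrightarrow> t \<in> {0..<T} \<Longrightarrow>
      (y e has_real_derivative (\<Sum>e'\<in>E. a e e' * y e' t)) (at t within {0..<T})"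
    and t: "t \<in> {0..<T}" and e: "e \<in> E"
  shows "y e t = 0"
proof -
  define N where "N s = (\<Sum>e\<in>E. (y e s)\<^sup>2)" for s
  \<comment> \<open>bounds the quadratic form because each product \<open>\<bar>y e s * y e' s\<bar>\<close> is at most \<open>N s\<close>\<close>
  define K where "K = (\<Sum>e\<in>E. \<Sum>e'\<in>E. 2 * \<bar>a e e'\<bar>)"
  define N' where "N' s = (\<Sum>e\<in>E. 2 * y e s * (\<Sum>e'\<in>E. a e e' * y e' s))" for s
  have le_N: "(y e s)\<^sup>2 \<le> N s" if "e \<in> E" for e s
    unfolding N_def using E that by (intro member_le_sum) auto
  have N': "N' s \<le> K * N s" for s
  proof -
    have "N' s = (\<Sum>e\<in>E. \<Sum>e'\<in>E. 2 * y e s * (a e e' * y e' s))"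
      by (simp add: N'_def sum_distrib_left)
    also have "\<dots> \<le> (\<Sum>e\<in>E. \<Sum>e'\<in>E. 2 * \<bar>a e e'\<bar> * N s)"
    proof (intro sum_mono)
      fix e e' assume *: "e \<in> E" "e' \<in> E"
      have "2 * \<bar>y e s * y e' s\<bar> \<le> (y e s)\<^sup>2 + (y e' s)\<^sup>2"
        using sum_squares_bound[of "\<bar>y e s\<bar>" "\<bar>y e' s\<bar>"] by (simp add: abs_mult)
      also have "\<dots> \<le> 2 * N s" using le_N[OF *(1)] le_N[OF *(2)] by (smt (verit))
      finally have le: "\<bar>y e s * y e' s\<bar> \<le> N s" by simp
      have "2 * y e s * (a e e' * y e' s) = 2 * (a e e' * (y e s * y e' s))" by simp
      also have "\<dots> \<le> 2 * (\<bar>a e e'\<bar> * \<bar>y e s * y e' s\<bar>)"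
        by (metis abs_ge_self abs_mult mult_left_mono zero_le_numeral)
      also have "\<dots> \<le> 2 * (\<bar>a e e'\<bar> * N s)"
        using le by (intro mult_left_mono) auto
      finally show "2 * y e s * (a e e' * y e' s) \<le> 2 * \<bar>a e e'\<bar> * N s" by simp
    qed
    also have "\<dots> = K * N s" by (simp add: K_def sum_distrib_right)
    finally show ?thesis .
  qed
  define G where "G s = N s * exp (- K * s)" for s
  have dG: "(G has_real_derivative (N' s - K * N s) * exp (- K * s)) (at s within {0..t})"
    if s: "s \<in> {0..t}" for s
  proof -
    have sT: "s \<in> {0..<T}" "{0..t} \<subseteq> {0..<T}" using s t by auto
    have "(y e has_real_derivative (\<Sum>e'\<in>E. a e e' * y e' s)) (at s within {0..t})" if "e \<in> E" for e
      using deriv[OF that sT(1)] sT(2) by (rule DERIV_subset)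
    then have "(N has_real_derivative N' s) (at s within {0..t})"
      unfolding N_def N'_def
      by (intro DERIV_sum) (auto intro!: derivative_eq_intros)
    then show ?thesis
      unfolding G_def by (auto intro!: derivative_eq_intros simp: algebra_simps)
  qed
  have "\<exists>s\<in>{0..t}. G t - G 0 = (N' s - K * N s) * exp (- K * s) * (t - 0)"
    using t dG by (intro mvt_very_simple) (auto simp: has_field_derivative_def)
  then obtain s where s: "s \<in> {0..t}" "G t - G 0 = (N' s - K * N s) * exp (- K * s) * t" by auto
  have "(N' s - K * N s) * exp (- K * s) * t \<le> 0"
    using N'[of s] t by (intro mult_nonpos_nonneg) auto
  moreover have "G 0 = 0" using y0 by (simp add: G_def N_def)
  ultimately have "G t \<le> 0" using s by simp
  then have "N t \<le> 0" by (simp add: G_def mult_le_0_iff)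
  then show ?thesis using le_N[OF e, of t] by (smt (verit) zero_eq_power2 zero_le_power2)
qed

section \<open>The discrete spaces of a mesh\<close>

locale discretization =
  fixes M :: mesh and F :: family and k :: nat
  assumes mesh: "torus_mesh (corners F) M"
    and complex: "well_defined_complex M F k"
begin

lemma finite_cells: "finite (cells M)" and finite_sides: "finite (sides M)"
  using mesh by (auto simp: torus_mesh_def)

lemma corners_pos: "corners F \<noteq> 0"
  by (cases F) auto

lemma cell_polygon: "C \<in> cells M \<Longrightarrow> is_polygon (corners F) C"
  using mesh by (auto simp: torus_mesh_def)

lemma cell_nonempty: "C \<in> cells M \<Longrightarrow> C \<noteq> []"
  using cell_polygon corners_pos by (fastforce simp: is_polygon_def)

lemma compact_cell: "C \<in> cells M \<Longrightarrow> compact (region C)"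
  and interior_cell: "C \<in> cells M \<Longrightarrow> interior (region C) \<noteq> {}"
  using compact_region interior_region cell_polygon corners_pos by blast+

lemma cells_cover:
  obtains C z where "C \<in> cells M" "z \<in> lattice M" "x - z \<in> region C"
proof -
  have "x \<in> (\<Union>C \<in> cells M. \<Union>z \<in> lattice M. region (shift z C))"
    using mesh by (auto simp: torus_mesh_def)
  then obtain C z where "C \<in> cells M" "z \<in> lattice M" "x \<in> region (shift z C)" by blast
  then show thesis
    using that region_shift[OF cell_nonempty] by fastforce
qed

lemma side_segment:
  assumes "S \<in> sides M" "p \<in> {left_cell M S, right_cell M S}"
  shows "fst p \<in> cells M" "snd p \<in> lattice M"
    and "segment S \<in> polygon_sides (shift (snd p) (fst p))"
    and "x \<in> segment S \<Longrightarrow> x - snd p \<in> region (fst p)"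
proof -
  have *: "neighbour M (normal S) S (left_cell M S)" "neighbour M (- normal S) S (right_cell M S)"
    using mesh assms(1) by (auto simp: torus_mesh_def)
  then show c: "fst p \<in> cells M" "snd p \<in> lattice M"
    and s: "segment S \<in> polygon_sides (shift (snd p) (fst p))"
    using assms(2) by (auto simp: neighbour_def case_prod_unfold)
  show "x - snd p \<in> region (fst p)" if "x \<in> segment S"
    using polygon_side_subset[OF s] region_shift[OF cell_nonempty[OF c(1)]] that by fastforce
qed

text \<open>A side of a cell has distinct end points because consecutive vertices of a cell are part of a
  noncollinear triple.\<close>

lemma side_length_pos:
  assumes S: "S \<in> sides M"
  shows "0 < side_length S"
proof -
  obtain C z where C: "C \<in> cells M" "segment S \<in> polygon_sides (shift z C)"
    using side_segment(1,3)[OF S, of "left_cell M S"] by auto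
  let ?n = "length C" and ?W = "shift z C"
  obtain i where i: "i < ?n" "segment S = closed_segment (?W ! i) (?W ! (Suc i mod ?n))"
    using C(2) by (auto simp: polygon_sides_def shift_def)
  have n: "?n = corners F" "\<not> collinear {C ! i, C ! (Suc i mod ?n), C ! (Suc (Suc i) mod ?n)}"
    using cell_polygon[OF C(1)] i(1) by (auto simp: is_polygon_def)
  then have "C ! i \<noteq> C ! (Suc i mod ?n)"
    by (metis collinear_2 insert_absorb2)
  moreover have "Suc i mod ?n < ?n" using i(1) by (intro mod_less_divisor) linarith
  ultimately have ne: "?W ! i \<noteq> ?W ! (Suc i mod ?n)"
    using i(1) by (simp add: shift_def)
  have "fst S \<noteq> snd S"
  proof
    assume "fst S = snd S"
    then have "closed_segment (?W ! i) (?W ! (Suc i mod ?n)) = {fst S}"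
      using i(2) by (simp add: segment_def)
    then show False
      using ne by (metis ends_in_segment(1) ends_in_segment(2) singletonD)
  qed
  then show ?thesis by (simp add: side_length_def)
qed

lemma space_B_eq: "space_B M F k = families (cells M) (B_loc F k)"
  by (auto simp: space_B_def families_def zero_fun_def)

lemma space_C_eq: "space_C M F k = families (cells M) (C_loc F k) \<times> families (sides M) (side_polys k)"
  by (auto simp: space_C_def families_def side_polys_def zero_fun_def)

sublocale B: inner_space_on "space_B M F k" "inner_B M"
proof -
  have "inner_space_on (families (cells M) (B_loc F k))
      (\<lambda>u v. \<Sum>C\<in>cells M. 1 * (LINT x:region C|lborel. u C x \<bullet> v C x))"
    by (rule inner_space_families)
      (auto simp: finite_cells poly_space_B_loc compact_cell interior_cell)
  then show "inner_space_on (space_B M F k) (inner_B M)"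
    by (simp add: space_B_eq inner_B_def[abs_def] cell_integral_def)
qed

sublocale C: inner_space_on "space_C M F k" "inner_C M"
proof -
  have 1: "inner_space_on (families (cells M) (C_loc F k))
      (\<lambda>u v. \<Sum>C\<in>cells M. 1 * (LINT x:region C|lborel. u C x \<bullet> v C x))"
    by (rule inner_space_families)
      (auto simp: finite_cells poly_space_C_loc compact_cell interior_cell)
  have 2: "inner_space_on (families (sides M) (side_polys k))
      (\<lambda>u v. \<Sum>S\<in>sides M. side_length S * (LINT x:{0..1}|lborel. u S x \<bullet> v S x))"
    by (rule inner_space_families)
      (auto simp: finite_sides poly_space_side_polys side_length_pos)
  show "inner_space_on (space_C M F k) (inner_C M)"
    using inner_space_Times[OF 1 2]
    by (simp add: space_C_eq inner_C_def[abs_def] cell_integral_def side_integral_def)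
qed

lemma A_periodic:
  assumes "f \<in> space_A M F k" "z \<in> lattice M"
  shows "f (x - z) = f x"
proof -
  have "f ((x - z) + z) = f (x - z)"
    using assms unfolding space_A_def periodic_def by blast
  then show ?thesis by simp
qed

lemma A_continuous: "f \<in> space_A M F k \<Longrightarrow> continuous_on UNIV f"
  by (simp add: space_A_def)

text \<open>A polynomial is determined by its values on a cell, which has interior points.\<close>

lemma cell_poly_unique:
  assumes C: "C \<in> cells M" and p: "real_polynomial_function p" and eq: "\<And>x. x \<in> region C \<Longrightarrow> p x = f x"
  shows "cell_poly f C = p"
  unfolding cell_poly_def
proof (rule the_equality)
  show "real_polynomial_function p \<and> (\<forall>x\<in>region C. p x = f x)" using p eq by blast
  fix q assume q: "real_polynomial_function q \<and> (\<forall>x\<in>region C. q x = f x)"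
  have "(\<lambda>x. q x - p x) = (\<lambda>_. 0)"
  proof (rule polynomial_function_eq_zero[OF _ open_interior interior_cell[OF C]])
    show "polynomial_function (\<lambda>x. q x - p x)"
      using p q by (simp add: real_polynomial_function_eq polynomial_function_diff)
    show "q x - p x = 0" if "x \<in> interior (region C)" for x
    proof -
      have "x \<in> region C" using that interior_subset by blast
      then show ?thesis using q eq[of x] by simp
    qed
  qed
  then show "q = p" by (simp add: fun_eq_iff)
qed

lemma cell_poly:
  assumes C: "C \<in> cells M" and f: "f \<in> space_A M F k"
  shows cell_poly_in: "cell_poly f C \<in> A_loc F k"
    and cell_poly_polynomial: "real_polynomial_function (cell_poly f C)"
    and cell_poly_eq: "x \<in> region C \<Longrightarrow> cell_poly f C x = f x"
proof -
  obtain p where p: "p \<in> A_loc F k" "\<And>x. x \<in> region C \<Longrightarrow> p x = f x"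
    using assms by (auto simp: space_A_def)
  have rp: "real_polynomial_function p"
    using p(1) poly_space_A_loc[of F k] by (auto simp: poly_space_def real_polynomial_function_eq)
  have "cell_poly f C = p" by (rule cell_poly_unique[OF C rp p(2)])
  with p rp show "cell_poly f C \<in> A_loc F k" "real_polynomial_function (cell_poly f C)"
    "x \<in> region C \<Longrightarrow> cell_poly f C x = f x"
    by auto
qed

lemma subspace_A: "subspace (space_A M F k)"
proof (rule subspaceI)
  have A: "subspace (A_loc F k)" using poly_space_A_loc by (auto simp: poly_space_def)
  show "0 \<in> space_A M F k"
    using subspace_0[OF A] by (auto simp: space_A_def periodic_def zero_fun_def)
  fix f g assume fg: "f \<in> space_A M F k" "g \<in> space_A M F k"
  show "f + g \<in> space_A M F k"
    unfolding space_A_def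
  proof (intro CollectI conjI ballI)
    show "periodic M (f + g)" using fg by (simp add: space_A_def periodic_def)
    show "continuous_on UNIV (f + g)"
      using fg unfolding plus_fun_def by (intro continuous_intros A_continuous)
    fix C assume C: "C \<in> cells M"
    show "\<exists>p\<in>A_loc F k. \<forall>x\<in>region C. (f + g) x = p x"
      using subspace_add[OF A cell_poly_in[OF C fg(1)] cell_poly_in[OF C fg(2)]]
        cell_poly_eq[OF C fg(1)] cell_poly_eq[OF C fg(2)]
      by (intro bexI[of _ "cell_poly f C + cell_poly g C"]) auto
  qed
next
  have A: "subspace (A_loc F k)" using poly_space_A_loc by (auto simp: poly_space_def)
  fix f c assume f: "f \<in> space_A M F k"
  show "c *\<^sub>R f \<in> space_A M F k"
    unfolding space_A_def
  proof (intro CollectI conjI ballI)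
    show "periodic M (c *\<^sub>R f)" using f by (simp add: space_A_def periodic_def)
    show "continuous_on UNIV (c *\<^sub>R f)"
      using f unfolding scaleR_fun_def by (intro continuous_intros A_continuous)
    fix C assume C: "C \<in> cells M"
    show "\<exists>p\<in>A_loc F k. \<forall>x\<in>region C. (c *\<^sub>R f) x = p x"
      using subspace_scale[OF A cell_poly_in[OF C f]] cell_poly_eq[OF C f]
      by (intro bexI[of _ "c *\<^sub>R cell_poly f C"]) auto
  qed
qed

text \<open>The lattice translates of the cells cover the plane and the functions are periodic. Choosing for
  every point a translated cell that contains it recovers a function linearly from its finitely
  many cell polynomials.\<close>

lemma finite_dim_A: "finite_dim (space_A M F k)"
proof -
  have "\<forall>x. \<exists>C z. C \<in> cells M \<and> z \<in> lattice M \<and> x - z \<in> region C"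
    using cells_cover by metis
  then obtain c z where cz: "\<And>x. c x \<in> cells M \<and> z x \<in> lattice M \<and> x - z x \<in> region (c x)"
    by metis
  \<comment> \<open>the linear recovery of a periodic function from its cell polynomials\<close>
  define h where "h p = (\<lambda>x. p (c x) (x - z x))" for p :: "pt list \<Rightarrow> pt \<Rightarrow> real"
  have "linear h" by (auto intro!: linearI simp: h_def fun_eq_iff)
  moreover have "finite_dim (families (cells M) (A_loc F k))"
    using finite_cells poly_space_A_loc by (auto simp: poly_space_def intro: finite_dim_families)
  ultimately have "finite_dim (h ` families (cells M) (A_loc F k))"
    by (rule finite_dim_linear_image)
  moreover have "space_A M F k \<subseteq> h ` families (cells M) (A_loc F k)"
  proof
    fix f assume f: "f \<in> space_A M F k"
    define p where "p C = (if C \<in> cells M then cell_poly f C else 0)" for C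
    have "p \<in> families (cells M) (A_loc F k)"
      using cell_poly_in[OF _ f] by (auto simp: p_def families_def)
    moreover have "f = h p"
    proof
      fix x
      show "f x = h p x"
        using cz[of x] cell_poly_eq[OF _ f, of "c x" "x - z x"] A_periodic[OF f, of "z x" x]
        by (simp add: h_def p_def)
    qed
    ultimately show "f \<in> h ` families (cells M) (A_loc F k)" by blast
  qed
  ultimately show ?thesis by (rule finite_dim_subset)
qed

lemma cell_integral_add:
  "C \<in> cells M \<Longrightarrow> continuous_on UNIV f \<Longrightarrow> continuous_on UNIV g \<Longrightarrow>
    cell_integral C (\<lambda>x. f x + g x) = cell_integral C f + cell_integral C g"
  unfolding cell_integral_def
  by (intro set_integral_add set_integrable_continuous_compact compact_cell)

text \<open>For definiteness, a function with vanishing norm has vanishing cell polynomials, so it is zero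
  on each representative cell, and by periodicity on all translates.\<close>

sublocale A: inner_space_on "space_A M F k" "inner_A M"
proof
  show "subspace (space_A M F k)" by (rule subspace_A)
  show "finite_dim (space_A M F k)" by (rule finite_dim_A)
  show "linear_form_on (space_A M F k) (\<lambda>x. inner_A M x y)" if y: "y \<in> space_A M F k" for y
    unfolding linear_form_on_def
  proof (intro conjI ballI allI)
    fix f g assume fg: "f \<in> space_A M F k" "g \<in> space_A M F k"
    have "cell_integral C (\<lambda>x. (f + g) x * y x) = cell_integral C (\<lambda>x. f x * y x) + cell_integral C (\<lambda>x. g x * y x)"
      if "C \<in> cells M" for C
      using cell_integral_add[OF that, of "\<lambda>x. f x * y x" "\<lambda>x. g x * y x"] fg y
      by (simp add: distrib_right continuous_intros A_continuous)
    then show "inner_A M (f + g) y = inner_A M f y + inner_A M g y"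
      by (simp add: inner_A_def sum.distrib)
  next
    fix f c assume "f \<in> space_A M F k"
    show "inner_A M (c *\<^sub>R f) y = c * inner_A M f y"
      by (simp add: inner_A_def cell_integral_def mult.assoc sum_distrib_left)
  qed
  show "inner_A M x y = inner_A M y x" for x y by (simp add: inner_A_def mult.commute)
  show "0 \<le> inner_A M x x" for x
    unfolding inner_A_def cell_integral_def by (intro sum_nonneg set_integral_lborel_nonneg) simp
  show "f = 0" if f: "f \<in> space_A M F k" and 0: "inner_A M f f = 0" for f
  proof
    fix x
    obtain C z where C: "C \<in> cells M" "z \<in> lattice M" "x - z \<in> region C" by (rule cells_cover)
    have "\<forall>C\<in>cells M. cell_integral C (\<lambda>x. f x * f x) = 0"
      using 0 unfolding inner_A_def
      by (subst (asm) sum_nonneg_eq_0_iff[OF finite_cells])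
        (auto simp: cell_integral_def intro!: set_integral_lborel_nonneg)
    then have "cell_integral C (\<lambda>x. f x * f x) = 0" using C(1) by blast
    moreover have "cell_integral C (\<lambda>x. f x * f x) = (LINT x:region C|lborel. cell_poly f C x \<bullet> cell_poly f C x)"
      unfolding cell_integral_def using cell_poly_eq[OF C(1) f] compact_cell[OF C(1)]
      by (intro set_lebesgue_integral_cong) (auto simp: borel_compact)
    ultimately have "cell_poly f C = (\<lambda>_. 0)"
      using cell_poly_polynomial[OF C(1) f]
      by (intro polynomial_function_L2_zero[OF _ compact_cell interior_cell])
        (auto simp: real_polynomial_function_eq C(1))
    then have "f (x - z) = 0"
      using cell_poly_eq[OF C(1) f C(3)] by simp
    then show "f x = 0 x"
      using A_periodic[OF f C(2)] by simp
  qed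
qed

section \<open>The discrete curl of a gradient\<close>

lemma cell_grad_in: "f \<in> space_A M F k \<Longrightarrow> cell_grad M f \<in> space_B M F k"
  and dist_curl_in: "u \<in> space_B M F k \<Longrightarrow> dist_curl M u \<in> space_C M F k"
  using complex by (auto simp: well_defined_complex_def)

lemma B_polynomial: "u \<in> space_B M F k \<Longrightarrow> C \<in> cells M \<Longrightarrow> polynomial_function (u C)"
  using poly_space_B_loc[of F k] by (auto simp: poly_space_def space_B_def)

lemma cell_grad_add:
  assumes f: "f \<in> space_A M F k" and g: "g \<in> space_A M F k"
  shows "cell_grad M (f + g) = cell_grad M f + cell_grad M g"
proof (intro ext)
  fix C x
  show "cell_grad M (f + g) C x = (cell_grad M f + cell_grad M g) C x"
  proof (cases "C \<in> cells M")
    case C: True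
    have "cell_poly (f + g) C = (\<lambda>x. cell_poly f C x + cell_poly g C x)"
      using cell_poly_polynomial[OF C] f g
      by (intro cell_poly_unique[OF C] real_polynomial_function.intros(3)) (auto simp: cell_poly_eq[OF C])
    then show ?thesis
      using C cell_poly_polynomial[OF C f] cell_poly_polynomial[OF C g]
      by (simp add: cell_grad_def grad_def dx_add dy_add differentiable_at_real_polynomial_function)
  qed (simp add: cell_grad_def)
qed

lemma cell_grad_scale:
  assumes f: "f \<in> space_A M F k"
  shows "cell_grad M (c *\<^sub>R f) = c *\<^sub>R cell_grad M f"
proof (intro ext)
  fix C x
  show "cell_grad M (c *\<^sub>R f) C x = (c *\<^sub>R cell_grad M f) C x"
  proof (cases "C \<in> cells M")
    case C: True
    have "cell_poly (c *\<^sub>R f) C = (\<lambda>x. c * cell_poly f C x)"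
      using cell_poly_polynomial[OF C f] f
      by (intro cell_poly_unique[OF C] real_polynomial_function.intros(2,4)) (auto simp: cell_poly_eq[OF C])
    then show ?thesis
      using C cell_poly_polynomial[OF C f]
      by (simp add: cell_grad_def grad_def dx_scale dy_scale differentiable_at_real_polynomial_function)
  qed (simp add: cell_grad_def)
qed

lemma perp_div_linear:
  assumes "u \<in> space_B M F k" "v \<in> space_B M F k" "C \<in> cells M"
  shows "perp_div (u C + v C) x = perp_div (u C) x + perp_div (v C) x"
    and "perp_div (c *\<^sub>R u C) x = c * perp_div (u C) x"
proof -
  have d: "(fst \<circ> w C) differentiable (at x)" "(snd \<circ> w C) differentiable (at x)"
    if "w \<in> space_B M F k" for w
    using B_polynomial[OF that assms(3)]
    by (auto intro!: differentiable_at_real_polynomial_function polynomial_function_fst polynomial_function_snd)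
  have eq: "fst \<circ> (u C + v C) = (\<lambda>x. (fst \<circ> u C) x + (fst \<circ> v C) x)"
    "snd \<circ> (u C + v C) = (\<lambda>x. (snd \<circ> u C) x + (snd \<circ> v C) x)"
    "fst \<circ> (c *\<^sub>R u C) = (\<lambda>x. c * (fst \<circ> u C) x)"
    "snd \<circ> (c *\<^sub>R u C) = (\<lambda>x. c * (snd \<circ> u C) x)"
    by auto
  have "dy (fst \<circ> (u C + v C)) x = dy (fst \<circ> u C) x + dy (fst \<circ> v C) x"
    "dx (snd \<circ> (u C + v C)) x = dx (snd \<circ> u C) x + dx (snd \<circ> v C) x"
    "dy (fst \<circ> (c *\<^sub>R u C)) x = c * dy (fst \<circ> u C) x"
    "dx (snd \<circ> (c *\<^sub>R u C)) x = c * dx (snd \<circ> u C) x"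
    unfolding eq by (intro dx_add dy_add dx_scale dy_scale d assms)+
  then show "perp_div (u C + v C) x = perp_div (u C) x + perp_div (v C) x"
    and "perp_div (c *\<^sub>R u C) x = c * perp_div (u C) x"
    by (simp_all only: perp_div_def algebra_simps)
qed

lemma dist_curl_add:
  assumes "u \<in> space_B M F k" "v \<in> space_B M F k"
  shows "dist_curl M (u + v) = dist_curl M u + dist_curl M v"
  using perp_div_linear(1)[OF assms]
  by (simp add: dist_curl_def prod_eq_iff fun_eq_iff jump_def perp_add algebra_simps inner_add_left inner_diff_left)

lemma dist_curl_scale:
  assumes "u \<in> space_B M F k"
  shows "dist_curl M (c *\<^sub>R u) = c *\<^sub>R dist_curl M u"
  using perp_div_linear(2)[OF assms assms, of _ c]
  by (simp add: dist_curl_def prod_eq_iff fun_eq_iff jump_def perp_scaleR algebra_simps inner_diff_left)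

text \<open>The functionals that define the two adjoints are linear, so the adjoints exist by the Riesz
  representation theorem.\<close>

lemma linear_form_grad:
  assumes "u \<in> space_B M F k"
  shows "linear_form_on (space_A M F k) (\<lambda>f. inner_B M u (cell_grad M f))"
  using B.linear_form_right[OF assms] cell_grad_in
  by (simp add: linear_form_on_def cell_grad_add cell_grad_scale)

lemma linear_form_dist_curl:
  assumes "f \<in> space_C M F k"
  shows "linear_form_on (space_B M F k) (\<lambda>u. inner_C M f (dist_curl M u))"
  using C.linear_form_right[OF assms] dist_curl_in
  by (simp add: linear_form_on_def dist_curl_add dist_curl_scale)

lemma proj_C_in:
  assumes g: "continuous_on UNIV g"
  shows "proj_C M F k g \<in> space_C M F k"
  unfolding proj_C_def
proof (rule C.represent_in)
  have cC: "continuous_on UNIV (fst \<phi> C)" if "\<phi> \<in> space_C M F k" "C \<in> cells M" for \<phi> C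
    using that poly_space_C_loc[of F k]
    by (auto simp: space_C_eq families_def poly_space_def intro!: continuous_on_polymonial_function)
  have cS: "continuous_on UNIV (snd \<phi> S)" if "\<phi> \<in> space_C M F k" "S \<in> sides M" for \<phi> S
    using that poly_space_side_polys[of k]
    by (auto simp: space_C_eq families_def poly_space_def intro!: continuous_on_polymonial_function)
  have gS: "continuous_on UNIV (\<lambda>s. g (side_point S s))" for S
    unfolding side_point_def using g
    by (intro continuous_on_compose2[OF g] continuous_on_linepath) auto
  have 1: "cell_integral C (\<lambda>x. g x * fst (\<phi> + \<psi>) C x) =
      cell_integral C (\<lambda>x. g x * fst \<phi> C x) + cell_integral C (\<lambda>x. g x * fst \<psi> C x)"
    if "\<phi> \<in> space_C M F k" "\<psi> \<in> space_C M F k" "C \<in> cells M" for \<phi> \<psi> C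
    unfolding fst_add plus_fun_apply distrib_left
    using that by (intro cell_integral_add continuous_on_mult g cC)
  have 2: "side_integral S (\<lambda>s. g (side_point S s) * snd (\<phi> + \<psi>) S s) =
      side_integral S (\<lambda>s. g (side_point S s) * snd \<phi> S s) + side_integral S (\<lambda>s. g (side_point S s) * snd \<psi> S s)"
    if "\<phi> \<in> space_C M F k" "\<psi> \<in> space_C M F k" "S \<in> sides M" for \<phi> \<psi> S
  proof -
    have "(LINT s:{0..1}|lborel. g (side_point S s) * snd (\<phi> + \<psi>) S s) =
        (LINT s:{0..1}|lborel. g (side_point S s) * snd \<phi> S s) +
        (LINT s:{0..1}|lborel. g (side_point S s) * snd \<psi> S s)"
      unfolding snd_add plus_fun_apply distrib_left
      using that by (intro set_integral_add set_integrable_continuous_compact compact_Icc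
          continuous_on_mult gS cS)
    then show ?thesis by (simp only: side_integral_def distrib_left)
  qed
  show "linear_form_on (space_C M F k) (\<lambda>\<phi>. (\<Sum>C \<in> cells M. cell_integral C (\<lambda>x. g x * fst \<phi> C x)) +
          (\<Sum>S \<in> sides M. side_integral S (\<lambda>s. g (side_point S s) * snd \<phi> S s)))"
    unfolding linear_form_on_def
  proof (intro conjI ballI allI)
    fix \<phi> \<psi> assume "\<phi> \<in> space_C M F k" "\<psi> \<in> space_C M F k"
    then show "(\<Sum>C \<in> cells M. cell_integral C (\<lambda>x. g x * fst (\<phi> + \<psi>) C x)) +
          (\<Sum>S \<in> sides M. side_integral S (\<lambda>s. g (side_point S s) * snd (\<phi> + \<psi>) S s)) =
        ((\<Sum>C \<in> cells M. cell_integral C (\<lambda>x. g x * fst \<phi> C x)) +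
          (\<Sum>S \<in> sides M. side_integral S (\<lambda>s. g (side_point S s) * snd \<phi> S s))) +
        ((\<Sum>C \<in> cells M. cell_integral C (\<lambda>x. g x * fst \<psi> C x)) +
          (\<Sum>S \<in> sides M. side_integral S (\<lambda>s. g (side_point S s) * snd \<psi> S s)))"
      by (simp only: 1 2 sum.distrib cong: sum.cong)
  next
    fix \<phi> c
    show "(\<Sum>C \<in> cells M. cell_integral C (\<lambda>x. g x * fst (c *\<^sub>R \<phi>) C x)) +
          (\<Sum>S \<in> sides M. side_integral S (\<lambda>s. g (side_point S s) * snd (c *\<^sub>R \<phi>) S s)) =
        c * ((\<Sum>C \<in> cells M. cell_integral C (\<lambda>x. g x * fst \<phi> C x)) +
          (\<Sum>S \<in> sides M. side_integral S (\<lambda>s. g (side_point S s) * snd \<phi> S s)))"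
      by (simp add: cell_integral_def side_integral_def mult.left_commute[of _ c] sum_distrib_left distrib_left)
  qed
qed

lemma side_point_in: "s \<in> {0..1} \<Longrightarrow> side_point S s \<in> segment S"
  unfolding side_point_def segment_def linepath_def by (auto simp: closed_segment_def)

text \<open>A function of the continuous space has the same values along a side seen from both neighbours,
  hence the same tangential derivative; the jump of its gradient is normal to the side. One-sided
  derivatives within the parameter interval are used, so the end points need no separate
  treatment.\<close>

lemma tangential_jump_grad:
  assumes f: "f \<in> space_A M F k" and S: "S \<in> sides M" and s: "s \<in> {0..1}"
  shows "jump M (cell_grad M f) S (side_point S s) \<bullet> (snd S - fst S) = 0"
proof -
  let ?f = "\<lambda>t. f (side_point S t)"
  have *: "(?f has_vector_derivative cell_grad M f (fst p) (side_point S s - snd p) \<bullet> (snd S - fst S))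
      (at s within {0..1})"
    if p: "p \<in> {left_cell M S, right_cell M S}" for p
  proof -
    note c = side_segment[OF S p]
    let ?q = "cell_poly f (fst p)"
    have q: "real_polynomial_function ?q" by (rule cell_poly_polynomial[OF c(1) f])
    have "((\<lambda>t. side_point S t - snd p) has_vector_derivative (snd S - fst S)) (at s within {0..1})"
      unfolding side_point_def
      using has_vector_derivative_diff[OF has_vector_derivative_linepath_within has_vector_derivative_const]
      by fastforce
    then have "((\<lambda>t. side_point S t - snd p) has_derivative (\<lambda>h. h *\<^sub>R (snd S - fst S))) (at s within {0..1})"
      by (simp add: has_vector_derivative_def)
    from has_derivative_compose[OF this real_polynomial_function_has_grad[OF q]]
    have "((\<lambda>t. ?q (side_point S t - snd p)) has_derivative
        (\<lambda>h. h *\<^sub>R (grad ?q (side_point S s - snd p) \<bullet> (snd S - fst S)))) (at s within {0..1})"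
      by simp
    then have "((\<lambda>t. ?q (side_point S t - snd p)) has_vector_derivative
        (grad ?q (side_point S s - snd p) \<bullet> (snd S - fst S))) (at s within {0..1})"
      by (simp add: has_vector_derivative_def)
    moreover have "?q (side_point S t - snd p) = f (side_point S t)" if "t \<in> {0..1}" for t
      using cell_poly_eq[OF c(1) f c(4)[OF side_point_in[OF that]]] A_periodic[OF f c(2)] by simp
    ultimately show ?thesis
      using c(1) s by (auto simp: cell_grad_def elim!: has_vector_derivative_transform[rotated 2])
  qed
  have "cell_grad M f (fst (left_cell M S)) (side_point S s - snd (left_cell M S)) \<bullet> (snd S - fst S)
      = cell_grad M f (fst (right_cell M S)) (side_point S s - snd (right_cell M S)) \<bullet> (snd S - fst S)"
    using s *[of "left_cell M S"] *[of "right_cell M S"]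
    by (intro vector_derivative_unique_within_closed_interval[of 0 1 s ?f]) auto
  then show ?thesis by (simp add: jump_def inner_diff_left)
qed

lemma normal_eq: "normal S = (- 1 / side_length S) *\<^sub>R perp (snd S - fst S)"
  by (simp add: normal_def perp_scaleR divide_inverse)

lemma curl_grad_cell: "f \<in> space_A M F k \<Longrightarrow> C \<in> cells M \<Longrightarrow> perp_div (cell_grad M f C) x = 0"
  by (simp add: cell_grad_def perp_div_grad cell_poly_polynomial)

lemma curl_grad_side:
  assumes "f \<in> space_A M F k" "S \<in> sides M" "s \<in> {0..1}"
  shows "snd (dist_curl M (cell_grad M f)) S s = 0"
  using tangential_jump_grad[OF assms] assms(2)
  by (simp add: dist_curl_def normal_eq jump_def inner_perp_perp perp_diff[symmetric])

text \<open>The complex property in the form needed for the adjoint: the side component of the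
  discrete curl is a function of a real parameter, and its values are computed above on \<open>{0..1}\<close>,
  the part of the line over which the product integrates.\<close>

lemma inner_C_curl_grad:
  assumes f: "f \<in> space_A M F k"
  shows "inner_C M g (dist_curl M (cell_grad M f)) = 0"
proof -
  have "cell_integral C (\<lambda>x. fst g C x * fst (dist_curl M (cell_grad M f)) C x) = 0" if "C \<in> cells M" for C
    using curl_grad_cell[OF f that] by (simp add: dist_curl_def cell_integral_def)
  moreover have "side_integral S (\<lambda>s. snd g S s * snd (dist_curl M (cell_grad M f)) S s) = 0"
    if "S \<in> sides M" for S
  proof -
    have "(LINT s:{0..1}|lborel. snd g S s * snd (dist_curl M (cell_grad M f)) S s) = (LINT s:{0..1::real}|lborel. 0)"
      using curl_grad_side[OF f that] by (intro set_lebesgue_integral_cong) auto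
    then show ?thesis by (simp add: side_integral_def)
  qed
  ultimately show ?thesis by (simp add: inner_C_def)
qed

section \<open>Preservation of the divergence constraint\<close>

text \<open>By the defining property of the adjoint the pairing is
  \<open>- inner_C M (proj_C M F k g) (dist_curl M (cell_grad M f))\<close>, and the discrete curl of a gradient
  vanishes. The projection has to lie in the discrete space for this pairing to be linear.\<close>

lemma initial_orthogonal:
  assumes g: "continuous_on UNIV g" and f: "f \<in> space_A M F k"
  shows "inner_B M (\<lambda>C x. - dist_curl_star M F k (proj_C M F k g) C x) (cell_grad M f) = 0"
proof -
  let ?c = "proj_C M F k g"
  have l: "linear_form_on (space_B M F k) (\<lambda>u. inner_C M ?c (dist_curl M u))"
    by (rule linear_form_dist_curl[OF proj_C_in[OF g]])
  have w: "dist_curl_star M F k ?c \<in> space_B M F k"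
    unfolding dist_curl_star_def by (rule B.represent_in[OF l])
  have "inner_B M (dist_curl_star M F k ?c) (cell_grad M f) = inner_C M ?c (dist_curl M (cell_grad M f))"
    unfolding dist_curl_star_def by (rule B.ip_represent[OF l cell_grad_in[OF f]])
  then have "inner_B M ((-1) *\<^sub>R dist_curl_star M F k ?c) (cell_grad M f) = 0"
    by (simp only: B.ip_scale[OF w cell_grad_in[OF f]] inner_C_curl_grad[OF f] mult_zero_right)
  moreover have "(-1) *\<^sub>R dist_curl_star M F k ?c = (\<lambda>C x. - dist_curl_star M F k ?c C x)"
    by (simp add: fun_eq_iff)
  ultimately show ?thesis by simp
qed

lemma grad_star_eq_zero:
  assumes "\<And>f. f \<in> space_A M F k \<Longrightarrow> inner_B M u (cell_grad M f) = 0"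
  shows "grad_star M F k u = (\<lambda>_. 0)"
  unfolding grad_star_def using A.represent_zero assms by (simp add: zero_fun_def)

lemma grad_star_in: "u \<in> space_B M F k \<Longrightarrow> grad_star M F k u \<in> space_A M F k"
  and inner_A_grad_star: "u \<in> space_B M F k \<Longrightarrow> f \<in> space_A M F k \<Longrightarrow>
    inner_A M (grad_star M F k u) f = inner_B M u (cell_grad M f)"
  unfolding grad_star_def by (auto intro: A.represent_in A.ip_represent linear_form_grad)

text \<open>The jump of a gradient is normal to the side and the flux is tangential.\<close>

lemma tangential_flux_zero:
  assumes f: "f \<in> space_A M F k" and S: "S \<in> sides M"
    and G: "\<And>x. x \<in> segment S \<Longrightarrow> G x \<bullet> normal S = 0"
  shows "side_integral S (\<lambda>s. jump M (cell_grad M f) S (side_point S s) \<bullet> G (side_point S s)) = 0"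
proof -
  have "jump M (cell_grad M f) S (side_point S s) \<bullet> G (side_point S s) = 0" if s: "s \<in> {0..1}" for s
  proof (rule inner_tangent_normal[OF _ tangential_jump_grad[OF f S s]])
    show "snd S - fst S \<noteq> 0" using side_length_pos[OF S] by (auto simp: side_length_def)
    show "G (side_point S s) \<bullet> perp (snd S - fst S) = 0"
      using G[OF side_point_in[OF s]] side_length_pos[OF S] by (simp add: normal_eq)
  qed
  then have "(LINT s:{0..1}|lborel. jump M (cell_grad M f) S (side_point S s) \<bullet> G (side_point S s))
      = (LINT s:{0..1::real}|lborel. 0)"
    by (intro set_lebesgue_integral_cong) auto
  then show ?thesis by (simp add: side_integral_def)
qed

text \<open>Testing the scheme with the gradient of a basis function \<open>e\<close> of the continuous space kills the
  curl term and the flux term. What remains is a linear differential system with constant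
  coefficients \<open>a e e'\<close> for the coordinates \<open>y e\<close> of the discrete divergence, with zero initial
  values.\<close>

lemma grad_star_stays_zero:
  assumes b: "\<And>C. C \<in> cells M \<Longrightarrow> set_integrable lborel (region C) b"
    and uh: "\<And>t. t \<in> {0..<T} \<Longrightarrow> uh t \<in> space_B M F k"
    and duh: "\<And>t C x. t \<in> {0..<T} \<Longrightarrow>
      ((\<lambda>\<tau>. uh \<tau> C x) has_vector_derivative duh t C x) (at t within {0..<T})"
    and init: "\<And>f. f \<in> space_A M F k \<Longrightarrow> inner_B M (uh 0) (cell_grad M f) = 0"
    and G: "\<And>t S x. t \<in> {0..<T} \<Longrightarrow> S \<in> sides M \<Longrightarrow> x \<in> segment S \<Longrightarrow> G t S x \<bullet> normal S = 0"
    and scheme: "\<And>t v. t \<in> {0..<T} \<Longrightarrow> v \<in> space_B M F k \<Longrightarrow>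
          (\<Sum>C \<in> cells M. cell_integral C (\<lambda>x. v C x \<bullet> duh t C x))
          - (\<Sum>C \<in> cells M. cell_integral C (\<lambda>x. (b x \<bullet> perp (uh t C x)) * perp_div (v C) x))
          + (\<Sum>S \<in> sides M. side_integral S
               (\<lambda>s. jump M v S (side_point S s) \<bullet> G t S (side_point S s)))
          + (\<Sum>C \<in> cells M. cell_integral C
               (\<lambda>x. (v C x \<bullet> b x) * (- grad_star M F k (uh t) x)))
          = 0"
    and t: "t \<in> {0..<T}"
  shows "grad_star M F k (uh t) = (\<lambda>_. 0)"
proof -
  obtain E where E: "A.orthonormal E" "\<forall>f\<in>space_A M F k. f = (\<Sum>e\<in>E. inner_A M f e *\<^sub>R e)"
    by (rule A.orthonormal_basis)
  have fE: "finite E" and EA: "e \<in> E \<Longrightarrow> e \<in> space_A M F k" for e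
    using E(1) by (auto simp: A.orthonormal_def)
  define y where "y e t = inner_B M (uh t) (cell_grad M e)" for e t
  \<comment> \<open>independent of time because \<open>b\<close> is\<close>
  define a where "a e e' = (\<Sum>C\<in>cells M. cell_integral C (\<lambda>x. (cell_grad M e C x \<bullet> b x) * e' x))" for e e'
  have w: "grad_star M F k (uh t) = (\<Sum>e\<in>E. y e t *\<^sub>R e)" if t: "t \<in> {0..<T}" for t
  proof -
    have "grad_star M F k (uh t) = (\<Sum>e\<in>E. inner_A M (grad_star M F k (uh t)) e *\<^sub>R e)"
      by (rule bspec[OF E(2) grad_star_in[OF uh[OF t]]])
    also have "\<dots> = (\<Sum>e\<in>E. y e t *\<^sub>R e)"
      using inner_A_grad_star[OF uh[OF t] EA] by (intro sum.cong) (auto simp: y_def)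
    finally show ?thesis .
  qed
  have deriv: "(y e has_real_derivative (\<Sum>e'\<in>E. a e e' * y e' t)) (at t within {0..<T})"
    if e: "e \<in> E" and t: "t \<in> {0..<T}" for e t
  proof -
    let ?v = "cell_grad M e"
    have v: "?v \<in> space_B M F k" by (rule cell_grad_in[OF EA[OF e]])
    have "t islimpt {t<..<T}" using t by (intro islimpt_greaterThanLessThan1) auto
    then have "t islimpt {0..<T}" by (rule islimpt_subset) (use t in auto)
    then have nb: "at t within {0..<T} \<noteq> bot" by (simp add: trivial_limit_within)
    let ?ev = "\<lambda>(i :: pt list \<times> pt) (u :: cellwise_vec). u (fst i) (snd i)"
    have lin: "linear (?ev i)" for i by (auto intro!: linearI)
    have sep: "u = 0" if "\<forall>i. ?ev i u = 0" for u :: cellwise_vec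
      using that by (auto simp: fun_eq_iff)
    have dev: "((\<lambda>\<tau>. ?ev i (uh \<tau>)) has_vector_derivative ?ev i (duh t)) (at t within {0..<T})" for i
      by (rule duh[OF t])
    \<comment> \<open>the evaluation points of a cellwise field are pairs of a cell and a point of the plane\<close>
    note pd = pointwise_derivative_finite_dim[of _ ?ev "{0..<T}" uh t "duh t", OF B.subspace B.finite_dim lin sep uh t nb dev]
    have duh_in: "duh t \<in> space_B M F k" by (rule pd(1))
    have 1: "(y e has_real_derivative inner_B M (duh t) ?v) (at t within {0..<T})"
      unfolding y_def by (rule pd(2)) (assumption, assumption, rule B.linear_form[OF v])
    have "cell_integral C (\<lambda>x. (?v C x \<bullet> b x) * (- grad_star M F k (uh t) x))
        = - (\<Sum>e'\<in>E. y e' t * cell_integral C (\<lambda>x. (?v C x \<bullet> b x) * e' x))" if C: "C \<in> cells M" for C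
    proof -
      have int: "set_integrable lborel (region C) (\<lambda>x. (?v C x \<bullet> b x) * e' x)" if "e' \<in> E" for e'
      proof -
        have "continuous_on UNIV (\<lambda>x. e' x *\<^sub>R ?v C x)"
          by (intro continuous_on_scaleR A_continuous[OF EA[OF that]]
              continuous_on_polymonial_function[OF B_polynomial[OF v C]])
        from set_integrable_inner_continuous[OF compact_cell[OF C] b[OF C] this]
        show ?thesis by (simp add: mult.commute)
      qed
      have "cell_integral C (\<lambda>x. (?v C x \<bullet> b x) * (- grad_star M F k (uh t) x))
          = cell_integral C (\<lambda>x. \<Sum>e'\<in>E. (- y e' t) * ((?v C x \<bullet> b x) * e' x))"
        by (simp add: w[OF t] sum_distrib_left mult_ac sum_negf)
      also have "\<dots> = (\<Sum>e'\<in>E. cell_integral C (\<lambda>x. (- y e' t) * ((?v C x \<bullet> b x) * e' x)))"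
        unfolding cell_integral_def set_lebesgue_integral_def scaleR_sum_right
        by (intro Bochner_Integration.integral_sum)
          (rule set_integrable_mult_right[OF int, unfolded set_integrable_def])
      also have "\<dots> = - (\<Sum>e'\<in>E. y e' t * cell_integral C (\<lambda>x. (?v C x \<bullet> b x) * e' x))"
        by (simp only: cell_integral_def set_integral_mult_right) (simp add: sum_negf)
      finally show ?thesis .
    qed
    then have "(\<Sum>C \<in> cells M. cell_integral C (\<lambda>x. (?v C x \<bullet> b x) * (- grad_star M F k (uh t) x)))
        = - (\<Sum>C\<in>cells M. \<Sum>e'\<in>E. y e' t * cell_integral C (\<lambda>x. (?v C x \<bullet> b x) * e' x))"
      by (simp add: sum_negf)
    also have "\<dots> = - (\<Sum>e'\<in>E. a e e' * y e' t)"
      by (subst sum.swap) (simp add: a_def sum_distrib_left mult.commute)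
    finally have 2: "(\<Sum>C \<in> cells M. cell_integral C (\<lambda>x. (?v C x \<bullet> b x) * (- grad_star M F k (uh t) x)))
        = - (\<Sum>e'\<in>E. a e e' * y e' t)" .
    have 3: "(\<Sum>C \<in> cells M. cell_integral C (\<lambda>x. (b x \<bullet> perp (uh t C x)) * perp_div (?v C) x)) = 0"
      by (intro sum.neutral) (simp add: curl_grad_cell[OF EA[OF e]] cell_integral_def)
    have 4: "(\<Sum>S \<in> sides M. side_integral S
               (\<lambda>s. jump M ?v S (side_point S s) \<bullet> G t S (side_point S s))) = 0"
      by (intro sum.neutral ballI tangential_flux_zero[OF EA[OF e]] G[OF t])
    have "inner_B M ?v (duh t) = (\<Sum>e'\<in>E. a e e' * y e' t)"
      using scheme[OF t v] unfolding 2 3 4 by (simp add: inner_B_def)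
    then show ?thesis
      using 1 B.sym[OF duh_in v] by simp
  qed
  have "y e t = 0" if "e \<in> E" for e
    using linear_ode_zero[OF fE _ deriv t that] init[OF EA] by (simp add: y_def)
  then show ?thesis by (simp add: w[OF t] fun_eq_iff)
qed

end

theorem proposition5:
  fixes M :: mesh and F :: family and k :: nat
    and b :: "pt \<Rightarrow> pt"
    and u0 :: "pt \<Rightarrow> pt" and f0 :: "pt \<Rightarrow> real"
    and fh0 :: cell_side and uh0 :: cellwise_vec
  assumes mesh: "torus_mesh (corners F) M"
    and complex: "well_defined_complex M F k"
    and b_periodic: "periodic M b"
    and b_integrable: "\<And>C. C \<in> cells M \<Longrightarrow> set_integrable lborel (region C) b"
    and f0: "periodic M f0" "C_infinity f0"
    and u0: "u0 = perp_grad f0"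
    and fh0: "fh0 = proj_C M F k f0"
    and uh0: "uh0 = (\<lambda>C x. - dist_curl_star M F k fh0 C x)"
  shows "grad_star M F k uh0 = (\<lambda>_. 0) \<and>
    (\<forall>(T :: real) (uh :: real \<Rightarrow> cellwise_vec) (duh :: real \<Rightarrow> cellwise_vec)
       (G :: real \<Rightarrow> side \<Rightarrow> pt \<Rightarrow> pt).
       0 < T \<longrightarrow>
       (\<forall>t \<in> {0..<T}. uh t \<in> space_B M F k) \<longrightarrow>
       (\<forall>t \<in> {0..<T}. \<forall>C x.
          ((\<lambda>\<tau>. uh \<tau> C x) has_vector_derivative duh t C x) (at t within {0..<T})) \<longrightarrow>
       uh 0 = uh0 \<longrightarrow>
       (\<forall>t \<in> {0..<T}. \<forall>S \<in> sides M.
          set_integrable lborel {0..1} (\<lambda>s. G t S (side_point S s))) \<longrightarrow>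
       (\<forall>t \<in> {0..<T}. \<forall>S \<in> sides M. \<forall>x \<in> segment S. G t S x \<bullet> normal S = 0) \<longrightarrow>
       (\<forall>t \<in> {0..<T}. \<forall>v \<in> space_B M F k.
          (\<Sum>C \<in> cells M. cell_integral C (\<lambda>x. v C x \<bullet> duh t C x))
          - (\<Sum>C \<in> cells M. cell_integral C (\<lambda>x. (b x \<bullet> perp (uh t C x)) * perp_div (v C) x))
          + (\<Sum>S \<in> sides M. side_integral S
               (\<lambda>s. jump M v S (side_point S s) \<bullet> G t S (side_point S s)))
          + (\<Sum>C \<in> cells M. cell_integral C
               (\<lambda>x. (v C x \<bullet> b x) * (- grad_star M F k (uh t) x)))
          = 0) \<longrightarrow>
       (\<forall>t \<in> {0..<T}. grad_star M F k (uh t) = (\<lambda>_. 0)))"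
proof -
  interpret discretization M F k by unfold_locales (fact mesh complex)+
  have "C_times 0 f0" using f0(2) unfolding C_infinity_def by blast
  then have cont: "continuous_on UNIV f0" by simp
  have init: "inner_B M uh0 (cell_grad M f) = 0" if "f \<in> space_A M F k" for f
    unfolding uh0 fh0 by (rule initial_orthogonal[OF cont that])
  show ?thesis
  proof (intro conjI allI impI ballI)
    show "grad_star M F k uh0 = (\<lambda>_. 0)" by (rule grad_star_eq_zero[OF init])
  next
    fix T :: real and uh duh :: "real \<Rightarrow> cellwise_vec" and G :: "real \<Rightarrow> side \<Rightarrow> pt \<Rightarrow> pt" and t :: real
    assume uh: "\<forall>t\<in>{0..<T}. uh t \<in> space_B M F k"
      and duh: "\<forall>t\<in>{0..<T}. \<forall>C x. ((\<lambda>\<tau>. uh \<tau> C x) has_vector_derivative duh t C x) (at t within {0..<T})"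
      and "uh 0 = uh0"
      and G: "\<forall>t\<in>{0..<T}. \<forall>S\<in>sides M. \<forall>x\<in>segment S. G t S x \<bullet> normal S = 0"
      and scheme: "\<forall>t \<in> {0..<T}. \<forall>v \<in> space_B M F k.
          (\<Sum>C \<in> cells M. cell_integral C (\<lambda>x. v C x \<bullet> duh t C x))
          - (\<Sum>C \<in> cells M. cell_integral C (\<lambda>x. (b x \<bullet> perp (uh t C x)) * perp_div (v C) x))
          + (\<Sum>S \<in> sides M. side_integral S
               (\<lambda>s. jump M v S (side_point S s) \<bullet> G t S (side_point S s)))
          + (\<Sum>C \<in> cells M. cell_integral C
               (\<lambda>x. (v C x \<bullet> b x) * (- grad_star M F k (uh t) x)))
          = 0"
      and t: "t \<in> {0..<T}"
    show "grad_star M F k (uh t) = (\<lambda>_. 0)"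
      by (rule grad_star_stays_zero[OF b_integrable uh[rule_format] duh[rule_format]
            init[folded \<open>uh 0 = uh0\<close>] G[rule_format] scheme[rule_format] t])
  qed
qed

end
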